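(* For all integers $k\ge 2$ and $m\ge 6$, \[GR_k(P_m)=\begin{cases}(n-1)k+n+1 & \text{if } m=2n,\\ (n-1)k+n+2 & \text{if } m=2n+1.\end{cases}\]
   Context: A Gallai $k$-coloring of a complete graph is an edge-coloring with colors from $\{1,\dots,k\}$ with no rainbow triangle (a triangle whose three edges receive three distinct colors). $P_m$ denotes the path on $m$ vertices. $GR_k(H)$ is the least positive integer $N$ such that every Gallai $k$-coloring of the complete graph $K_N$ contains a monochromatic copy of $H$ (a subgraph isomorphic to $H$ all of whose edges have the same color). *)

theory Defs
  imports "HOL-Library.Ramsey"
begin

text \<open>
  A graph is a pair of a vertex set and a set of edges, each edge being a two-element set of
  vertices (\<open>[V]\<^bsup>2\<^esup>\<close> from \<^theory>\<open>HOL-Library.Ramsey\<close> is the set of all two-element subsets of \<open>V\<close>).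
\<close>

type_synonym 'a graph = "'a set \<times> 'a set set"

abbreviation verts :: "'a graph \<Rightarrow> 'a set" where
  "verts \<equiv> fst"

abbreviation edges :: "'a graph \<Rightarrow> 'a set set" where
  "edges \<equiv> snd"

definition is_graph :: "'a graph \<Rightarrow> bool" where
  "is_graph G \<longleftrightarrow> edges G \<subseteq> [verts G]\<^bsup>2\<^esup>"

definition subgraph :: "'a graph \<Rightarrow> 'a graph \<Rightarrow> bool" where
  "subgraph G' G \<longleftrightarrow> is_graph G' \<and> verts G' \<subseteq> verts G \<and> edges G' \<subseteq> edges G"

definition isomorphic :: "'a graph \<Rightarrow> 'b graph \<Rightarrow> bool" where
  "isomorphic G H \<longleftrightarrow> (\<exists>f. bij_betw f (verts G) (verts H) \<and>
     (\<forall>x\<in>verts G. \<forall>y\<in>verts G. {x, y} \<in> edges G \<longleftrightarrow> {f x, f y} \<in> edges H))"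

definition complete_graph :: "nat \<Rightarrow> nat graph" where
  "complete_graph N = ({..<N}, [{..<N}]\<^bsup>2\<^esup>)"

definition path_graph :: "nat \<Rightarrow> nat graph" where
  "path_graph m = ({..<m}, {{i, Suc i} | i. Suc i < m})"

definition edge_coloring :: "nat \<Rightarrow> 'a graph \<Rightarrow> ('a set \<Rightarrow> nat) \<Rightarrow> bool" where
  "edge_coloring k G c \<longleftrightarrow> (\<forall>e\<in>edges G. c e \<in> {1..k})"

definition rainbow_triangle :: "'a graph \<Rightarrow> ('a set \<Rightarrow> nat) \<Rightarrow> 'a \<Rightarrow> 'a \<Rightarrow> 'a \<Rightarrow> bool" where
  "rainbow_triangle G c x y z \<longleftrightarrow>
     {x, y} \<in> edges G \<and> {y, z} \<in> edges G \<and> {x, z} \<in> edges G \<and>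
     c {x, y} \<noteq> c {y, z} \<and> c {y, z} \<noteq> c {x, z} \<and> c {x, y} \<noteq> c {x, z}"

definition gallai_coloring :: "nat \<Rightarrow> 'a graph \<Rightarrow> ('a set \<Rightarrow> nat) \<Rightarrow> bool" where
  "gallai_coloring k G c \<longleftrightarrow> edge_coloring k G c \<and> \<not> (\<exists>x y z. rainbow_triangle G c x y z)"

definition has_monochromatic_copy :: "'a graph \<Rightarrow> ('a set \<Rightarrow> nat) \<Rightarrow> 'b graph \<Rightarrow> bool" where
  "has_monochromatic_copy G c H \<longleftrightarrow>
     (\<exists>G'. subgraph G' G \<and> isomorphic H G' \<and> (\<exists>i. \<forall>e\<in>edges G'. c e = i))"

definition gallai_ramsey_property :: "nat \<Rightarrow> 'b graph \<Rightarrow> nat \<Rightarrow> bool" where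
  "gallai_ramsey_property k H N \<longleftrightarrow>
     (\<forall>c. gallai_coloring k (complete_graph N) c \<longrightarrow>
          has_monochromatic_copy (complete_graph N) c H)"

definition GR :: "nat \<Rightarrow> 'b graph \<Rightarrow> nat" where
  "GR k H = (LEAST N. 0 < N \<and> gallai_ramsey_property k H N)"

text \<open>By Ramsey's theorem the minimum defining \<open>GR\<close> ranges over a nonempty set.\<close>

lemma gallai_ramsey_property_exists:
  assumes "is_graph H" and "finite (verts H)"
  shows "\<exists>N>0. gallai_ramsey_property k H N"
proof -
  define q where "q = card (verts H)"
  obtain N0 :: nat where N0: "partn_lst {..<N0} (replicate k q) 2"
    using ramsey_full by blast
  define N where "N = Suc N0"
  have N: "partn_lst {..<N} (replicate k q) 2"
    using partn_lst_greater_resource[OF N0] by (simp add: N_def)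
  have "has_monochromatic_copy (complete_graph N) c H"
    if c: "gallai_coloring k (complete_graph N) c" for c
  proof -
    have "(\<lambda>e. c e - 1) \<in> [{..<N}]\<^bsup>2\<^esup> \<rightarrow> {..<length (replicate k q)}"
    proof (rule Pi_I)
      fix e assume "e \<in> [{..<N}]\<^bsup>2\<^esup>"
      then have "c e \<in> {1..k}"
        using c by (simp add: gallai_coloring_def edge_coloring_def complete_graph_def)
      then show "c e - 1 \<in> {..<length (replicate k q)}" by auto
    qed
    then obtain i where "i < k" and "monochromatic {..<N} (replicate k q ! i) 2 (\<lambda>e. c e - 1) i"
      using N unfolding partn_lst_def by fastforce
    then obtain S where S: "S \<in> [{..<N}]\<^bsup>q\<^esup>" and mono: "(\<lambda>e. c e - 1) ` [S]\<^bsup>2\<^esup> \<subseteq> {i}"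
      unfolding monochromatic_def by auto
    have "finite S" "card S = q" and SN: "S \<subseteq> {..<N}"
      using S by (auto simp: nsets_def)
    then obtain f where f: "bij_betw f (verts H) S"
      using assms(2) q_def finite_same_card_bij by metis
    define G' where "G' = (S, (\<lambda>e. f ` e) ` edges H)"
    have inj: "inj_on f (verts H)" and img: "f ` verts H = S"
      using f by (auto simp: bij_betw_def)
    have HE: "e \<subseteq> verts H \<and> finite e \<and> card e = 2" if "e \<in> edges H" for e
      using assms(1) that by (auto simp: is_graph_def nsets_def)
    have sub: "(\<lambda>e. f ` e) ` edges H \<subseteq> [S]\<^bsup>2\<^esup>"
    proof (rule image_subsetI)
      fix e assume "e \<in> edges H"
      then have e: "e \<subseteq> verts H" "finite e" "card e = 2" using HE by auto
      then have "card (f ` e) = 2" using inj by (simp add: card_image inj_on_subset)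
      then show "f ` e \<in> [S]\<^bsup>2\<^esup>" using e img by (auto simp: nsets_def)
    qed
    have "subgraph G' (complete_graph N)"
      using sub SN nsets_mono[OF SN, of 2]
      by (auto simp: subgraph_def is_graph_def G'_def complete_graph_def)
    moreover have "isomorphic H G'"
      unfolding isomorphic_def
    proof (intro exI conjI ballI)
      show "bij_betw f (verts H) (verts G')" using f by (simp add: G'_def)
      fix x y assume xy: "x \<in> verts H" "y \<in> verts H"
      show "{x, y} \<in> edges H \<longleftrightarrow> {f x, f y} \<in> edges G'"
      proof
        assume "{x, y} \<in> edges H"
        then have "f ` {x, y} \<in> edges G'" unfolding G'_def by (simp del: image_insert)
        then show "{f x, f y} \<in> edges G'" by simp
      next
        assume "{f x, f y} \<in> edges G'"
        then obtain e where e: "e \<in> edges H" "f ` {x, y} = f ` e"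
          by (auto simp: G'_def)
        then have "{x, y} = e"
          using HE[OF e(1)] xy inj by (metis empty_subsetI insert_subset inj_on_image_eq_iff)
        then show "{x, y} \<in> edges H" using e by simp
      qed
    qed
    moreover have "c e = Suc i" if "e \<in> edges G'" for e
    proof -
      have eS: "e \<in> [S]\<^bsup>2\<^esup>" using that sub by (auto simp: G'_def)
      then have "c e - 1 = i" using mono by auto
      moreover have "c e \<in> {1..k}"
        using c eS nsets_mono[OF SN, of 2]
        by (auto simp: gallai_coloring_def edge_coloring_def complete_graph_def)
      ultimately show ?thesis by auto
    qed
    ultimately show ?thesis unfolding has_monochromatic_copy_def by blast
  qed
  then show ?thesis unfolding gallai_ramsey_property_def N_def by blast
qed

end

theory Submission
  imports Defs
begin

text \<open>
  Let \<open>p\<^sub>i\<close> be the number of vertices of a longest path of colour \<open>i\<close>. The upper bound follows from the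
  estimate \<open>|V| \<le> 1 + max\<^sub>i (p\<^sub>i div 2) + (\<Sum>\<^sub>i (p\<^sub>i - 1) div 2)\<close> for Gallai colourings of a complete graph on
  \<open>V\<close>, by induction on \<open>|V|\<close>. Take a Gallai partition: all edges between different parts are red or
  blue, and each pair of parts sees only one colour. If some part is larger than its red
  neighbourhood and larger than its blue neighbourhood, then the estimate for this part extends
  to \<open>V\<close>, because each outside vertex prolongs a path by two vertices. Otherwise two
  colours suffice: for a longest red path \<open>P\<close>, at least as long as all blue paths, there is a blue path
  on at least \<open>2 |V - P| + 1\<close> vertices. Such a path, alternating between \<open>P\<close> and \<open>V - P\<close>, is
  first found among the edges that are not red; those joining two vertices of one part
  are then removed by 2-opt moves and exchanges, for which a part is never too large.
\<close>

section \<open>Longest paths\<close>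

definition path_in :: "('a \<Rightarrow> 'a \<Rightarrow> bool) \<Rightarrow> 'a set \<Rightarrow> 'a list \<Rightarrow> bool" where
  "path_in E V xs \<longleftrightarrow> distinct xs \<and> set xs \<subseteq> V \<and> successively E xs"

definition path_number :: "('a \<Rightarrow> 'a \<Rightarrow> bool) \<Rightarrow> 'a set \<Rightarrow> nat" where
  "path_number E V = Max (length ` {xs. path_in E V xs})"

lemma finite_paths: "finite V \<Longrightarrow> finite {xs. path_in E V xs}"
  unfolding path_in_def by (rule finite_subset[OF _ finite_subset_distinct[of V]]) auto

lemma path_in_Nil [simp]: "path_in E V []"
  by (simp add: path_in_def)

lemma path_in_mono:
  assumes "path_in E V xs" "V \<subseteq> W" "\<And>x y. x \<in> V \<Longrightarrow> y \<in> V \<Longrightarrow> E x y \<Longrightarrow> F x y"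
  shows "path_in F W xs"
  using assms unfolding path_in_def by (auto elim!: successively_mono)

lemma length_le_path_number: "finite V \<Longrightarrow> path_in E V xs \<Longrightarrow> length xs \<le> path_number E V"
  unfolding path_number_def by (rule Max_ge) (auto simp: finite_paths)

lemma path_number_attained:
  assumes "finite V"
  obtains xs where "path_in E V xs" "length xs = path_number E V"
proof -
  have "path_number E V \<in> length ` {xs. path_in E V xs}"
    unfolding path_number_def by (rule Max_in) (use assms finite_paths path_in_Nil in \<open>auto intro: exI[of _ "[]"]\<close>)
  then show ?thesis using that by auto
qed

lemma path_number_mono:
  assumes "finite W" "V \<subseteq> W" "\<And>x y. x \<in> V \<Longrightarrow> y \<in> V \<Longrightarrow> E x y \<Longrightarrow> F x y"
  shows "path_number E V \<le> path_number F W"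
proof -
  obtain xs where xs: "path_in E V xs" "length xs = path_number E V"
    using path_number_attained[OF finite_subset[OF assms(2,1)]] .
  have "path_in F W xs" using xs(1) assms(2,3) by (rule path_in_mono)
  then show ?thesis using length_le_path_number[OF assms(1)] xs(2) by metis
qed

lemma path_number_pos:
  assumes "finite V" "V \<noteq> {}"
  shows "0 < path_number E V"
proof -
  obtain v where "v \<in> V" using assms by auto
  then have "path_in E V [v]" by (simp add: path_in_def)
  then show ?thesis using length_le_path_number[OF assms(1)] by fastforce
qed

section \<open>Vertex covers of a path\<close>

text \<open>The summand for the head carries the induction: in front of a vertex outside
  \<open>Z\<close> the next one must lie in \<open>Z\<close>.\<close>

lemma cover_path_aux:
  assumes "successively (\<lambda>a b. Z a \<or> Z b) xs" "xs \<noteq> []" "Z (last xs)"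
  shows "length xs + (if Z (hd xs) then 1 else 0) \<le> 2 * length (filter Z xs)"
  using assms
proof (induction xs)
  case (Cons x xs)
  then show ?case by (cases xs) (auto split: if_splits)
qed simp

text \<open>Vertices outside \<open>Z\<close> are isolated on the path and never at its ends, so
  they are fewer than those in \<open>Z\<close>.\<close>

lemma cover_path:
  assumes "successively (\<lambda>a b. Z a \<or> Z b) xs" "xs \<noteq> []" "Z (hd xs)" "Z (last xs)"
  shows "length xs + 1 \<le> 2 * length (filter Z xs)"
  using cover_path_aux[OF assms(1,2,4)] assms(3) by simp

text \<open>Serves the lower bound, where a path may start and end outside the covering
  block.\<close>

lemma cover_path_free:
  assumes "successively (\<lambda>a b. Z a \<or> Z b) xs"
  shows "length xs \<le> 2 * length (filter Z xs) + 1"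
  using assms
proof (induction xs rule: induct_list012)
  case (3 x y zs)
  then show ?case by (cases zs) (auto split: if_splits)
qed auto

lemma length_filter_card:
  assumes "distinct xs"
  shows "length (filter Z xs) = card {x \<in> set xs. Z x}"
  using assms by (metis distinct_card distinct_filter set_filter)

section \<open>Interleaving two joined sets\<close>

fun weave :: "'a list \<Rightarrow> 'a list \<Rightarrow> 'a list" where
  "weave (x # xs) (y # ys) = x # y # weave xs ys"
| "weave xs [] = xs"
| "weave [] ys = ys"

lemma set_weave [simp]: "set (weave xs ys) = set xs \<union> set ys"
  by (induction xs ys rule: weave.induct) auto

lemma length_weave [simp]: "length (weave xs ys) = length xs + length ys"
  by (induction xs ys rule: weave.induct) auto

lemma distinct_weave:
  "distinct xs \<Longrightarrow> distinct ys \<Longrightarrow> set xs \<inter> set ys = {} \<Longrightarrow> distinct (weave xs ys)"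
  by (induction xs ys rule: weave.induct) auto

lemma hd_weave: "xs \<noteq> [] \<Longrightarrow> hd (weave xs ys) = hd xs"
  by (cases xs; cases ys) auto

lemma successively_weave:
  assumes "\<And>x y. x \<in> set xs \<Longrightarrow> y \<in> set ys \<Longrightarrow> E x y \<and> E y x"
    and "length ys \<le> length xs" "successively E (drop (length ys) xs)"
  shows "successively E (weave xs ys)"
  using assms
proof (induction xs ys rule: weave.induct)
  case (1 x xs y ys)
  have "successively E (weave xs ys)" using 1 by auto
  moreover have "xs \<noteq> [] \<Longrightarrow> E y (hd (weave xs ys))"
    using 1(2) by (simp add: hd_weave)
  moreover have "xs = [] \<Longrightarrow> weave xs ys = []" using 1(3) by simp
  ultimately show ?case using 1(2)[of x y]
    by (cases "xs = []"; cases "weave xs ys") (auto simp: successively_Cons)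
qed auto

lemma join_path:
  assumes fin: "finite X" "finite Y" and disj: "X \<inter> Y = {}"
    and join: "\<And>x y. x \<in> X \<Longrightarrow> y \<in> Y \<Longrightarrow> E x y \<and> E y x"
    and le: "card Y \<le> card X"
    and q: "path_in E X q"
  shows "min (length q + 2 * card Y) (card X + card Y) \<le> path_number E (X \<union> Y)"
proof -
  have dq: "distinct q" "set q \<subseteq> X" "successively E q" using q by (auto simp: path_in_def)
  obtain es where es: "set es = X - set q" "distinct es"
    using finite_distinct_list[of "X - set q"] fin by auto
  obtain ys where ys: "set ys = Y" "distinct ys"
    using finite_distinct_list fin by blast
  have cy: "length ys = card Y" using ys distinct_card by metis
  have ce: "length es + length q = card X"
  proof -
    have "card X = card (set q) + card (X - set q)"
      using dq(2) fin by (metis card_mono card_Diff_subset finite_subset le_add_diff_inverse)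
    then show ?thesis using es dq(1) distinct_card by (metis add.commute)
  qed
  define L where "L = take (card Y) es @ q"
  have "path_in E (X \<union> Y) (weave L ys)"
    unfolding path_in_def
  proof (intro conjI)
    have sL: "set L \<subseteq> X" using es dq set_take_subset[of "card Y" es] by (auto simp: L_def)
    show "distinct (weave L ys)"
      using sL ys disj es dq set_take_subset[of "card Y" es]
      by (intro distinct_weave) (auto simp: L_def)
    show "set (weave L ys) \<subseteq> X \<union> Y" using sL ys by auto
    show "successively E (weave L ys)"
    proof (rule successively_weave)
      show "length ys \<le> length L" using cy ce le by (auto simp: L_def)
      show "successively E (drop (length ys) L)"
        using dq(3) successively_append_iff[of E "take k q" "drop k q" for k]
        unfolding L_def cy by simp
      show "E x y \<and> E y x" if "x \<in> set L" "y \<in> set ys" for x y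
        using join that sL ys by auto
    qed
  qed
  then have "length (weave L ys) \<le> path_number E (X \<union> Y)"
    using fin by (intro length_le_path_number) auto
  then show ?thesis using cy ce by (auto simp: L_def)
qed

section \<open>Two-coloured modular partitions\<close>

lemma not_successivelyE:
  assumes "\<not> successively R xs"
  obtains A x y D where "xs = A @ [x, y] @ D" "\<not> R x y"
proof -
  have "\<exists>A x y D. xs = A @ [x, y] @ D \<and> \<not> R x y"
    using assms
  proof (induction xs rule: induct_list012)
    case (3 x y zs)
    show ?case
    proof (cases "R x y")
      case False
      then show ?thesis by (metis append_Cons append_Nil)
    next
      case True
      then obtain A a b D where "y # zs = A @ [a, b] @ D" "\<not> R a b"
        using 3 by auto
      then show ?thesis by (metis append_Cons)
    qed
  qed auto
  then show ?thesis using that by blast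
qed

fun count_adj :: "('a \<Rightarrow> 'a \<Rightarrow> bool) \<Rightarrow> 'a list \<Rightarrow> nat" where
  "count_adj R (x # y # zs) = of_bool (R x y) + count_adj R (y # zs)"
| "count_adj R _ = 0"

lemma count_adj_append:
  "count_adj R (xs @ ys) = count_adj R xs + count_adj R ys
     + of_bool (xs \<noteq> [] \<and> ys \<noteq> [] \<and> R (last xs) (hd ys))"
proof (induction R xs rule: count_adj.induct)
  case ("2_2" R v)
  then show ?case by (cases ys) auto
qed auto

lemma count_adj_rev:
  assumes "\<And>x y. R x y \<longleftrightarrow> R y x"
  shows "count_adj R (rev xs) = count_adj R xs"
proof (induction xs)
  case (Cons x xs)
  then show ?case using assms by (cases xs) (auto simp: count_adj_append)
qed simp

lemma count_adj_eq_0: "count_adj R xs = 0 \<longleftrightarrow> successively (\<lambda>x y. \<not> R x y) xs"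
  by (induction xs rule: induct_list012) auto

lemma length_alternating:
  assumes "successively (\<lambda>x y. Z x \<noteq> Z y) xs" "xs \<noteq> []"
  shows "2 * length (filter Z xs) + 1 = length xs + of_bool (Z (hd xs)) + of_bool (Z (last xs))"
  using assms
proof (induction xs rule: induct_list012)
  case (3 x y zs)
  then show ?case by auto
qed auto

text \<open>The 2-opt move: by symmetry pairs inside \<open>K\<close> stay good, so only the two
  junctions need checking.\<close>

lemma path_in_reverse_segment:
  assumes "path_in E V (A @ [s] @ K @ D)" "K \<noteq> []" "\<And>x y. E x y \<Longrightarrow> E y x"
    and "E s (last K)" "D = [] \<or> E (hd K) (hd D)"
  shows "path_in E V (A @ [s] @ rev K @ D)"
proof -
  have 1: "successively E A" "successively E K" "successively E D" "A = [] \<or> E (last A) s"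
    using assms(1,2) by (auto simp: path_in_def successively_append_iff successively_Cons)
  have "successively E (rev K)"
    unfolding successively_rev by (rule successively_mono[OF 1(2)]) (rule assms(3))
  then have "successively E (A @ [s] @ rev K @ D)"
    using 1 assms(2,4,5) by (auto simp: successively_append_iff successively_Cons hd_rev last_rev hd_append)
  then show ?thesis using assms(1) by (auto simp: path_in_def)
qed

text \<open>Only the two junctions change. The new ones are added to the old count and the old ones
  to the new count, since subtraction on natural numbers truncates.\<close>

lemma count_adj_reverse_segment:
  assumes "K \<noteq> []" "\<And>x y. R x y \<longleftrightarrow> R y x"
  shows "count_adj R (A @ [s] @ K @ D) + of_bool (R s (last K)) + of_bool (D \<noteq> [] \<and> R (hd K) (hd D))
    = count_adj R (A @ [s] @ rev K @ D) + of_bool (R s (hd K)) + of_bool (D \<noteq> [] \<and> R (last K) (hd D))"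
proof -
  have "count_adj R (A @ [s] @ L @ D) = count_adj R (A @ [s]) + count_adj R L + count_adj R D
     + of_bool (R s (hd L)) + of_bool (D \<noteq> [] \<and> R (last L) (hd D))" if "L \<noteq> []" for L
    using that count_adj_append[of R "A @ [s]" "L @ D"] count_adj_append[of R L D] by simp
  from this[of K] this[of "rev K"] show ?thesis
    using assms(1) count_adj_rev[of R K] assms(2) by (simp add: hd_rev last_rev)
qed

text \<open>The case of a Gallai partition without a dominant part; the fibres of \<open>f\<close>
  are the parts. Pairs inside a part are neither red nor blue here, whatever colour they have in the
  application.\<close>

locale two_coloured_modules =
  fixes V :: "'a set" and red :: "'a \<Rightarrow> 'a \<Rightarrow> bool" and f :: "'a \<Rightarrow> 'b" and P :: "'a list"
  assumes fin: "finite V"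
    and red_sym: "red x y \<Longrightarrow> red y x"
    and red_cross: "red x y \<Longrightarrow> f x \<noteq> f y"
    and red_module: "x \<in> V \<Longrightarrow> x' \<in> V \<Longrightarrow> f x = f x' \<Longrightarrow> red x y \<Longrightarrow> red x' y"
    and P: "path_in red V P" "P \<noteq> []"
    and red_le: "path_in red V xs \<Longrightarrow> length xs \<le> length P"
    and blue_le: "path_in (\<lambda>x y. \<not> red x y \<and> f x \<noteq> f y) V xs \<Longrightarrow> length xs \<le> length P"
    and balanced: "x \<in> V \<Longrightarrow> card {y \<in> V. f y = f x} \<le> card {y \<in> V. red x y}
      \<or> card {y \<in> V. f y = f x} \<le> card {y \<in> V. \<not> red x y \<and> f x \<noteq> f y}"
begin

abbreviation blue where "blue x y \<equiv> \<not> red x y \<and> f x \<noteq> f y"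
abbreviation U where "U \<equiv> V - set P"
abbreviation inP where "inP Q \<equiv> length (filter (\<lambda>x. x \<in> set P) Q)"
abbreviation inU where "inU Q \<equiv> length (filter (\<lambda>x. x \<notin> set P) Q)"
abbreviation sim where "sim x y \<equiv> f x = f y"

text \<open>Adjacent pairs with equal labels are tolerated between \<^term>\<open>U\<close> and \<^term>\<open>P\<close>
  only, and are to be removed later.\<close>
definition link where
  "link x y \<longleftrightarrow> \<not> red x y \<and> (f x = f y \<longrightarrow> (x \<in> set P) \<noteq> (y \<in> set P))"

text \<open>The first version of the desired blue path lives in this relation: it alternates
  strictly between \<open>P\<close> and \<open>U\<close> but may still join vertices of one
  part.\<close>

definition alt where
  "alt x y \<longleftrightarrow> \<not> red x y \<and> (x \<in> set P) \<noteq> (y \<in> set P)"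

lemma distP: "distinct P" and PV: "set P \<subseteq> V" and succP: "successively red P"
  using P by (auto simp: path_in_def)

lemma red_commute: "red x y \<longleftrightarrow> red y x"
  using red_sym by blast

lemma red_label: "x \<in> V \<Longrightarrow> x' \<in> V \<Longrightarrow> f x = f x' \<Longrightarrow> red x y \<longleftrightarrow> red x' y"
  using red_module by metis

lemma path_in_rev:
  assumes "\<And>x y. E x y \<Longrightarrow> E y x" "path_in E V Q"
  shows "path_in E V (rev Q)"
  using assms by (auto simp: path_in_def elim!: successively_mono)

lemma outside_hd: "u \<in> U \<Longrightarrow> \<not> red u (hd P)"
proof
  assume u: "u \<in> U" "red u (hd P)"
  then have "path_in red V (u # P)" using P by (auto simp: path_in_def successively_Cons)
  then show False using red_le by fastforce
qed

lemma outside_last: "u \<in> U \<Longrightarrow> \<not> red u (last P)"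
proof
  assume u: "u \<in> U" "red u (last P)"
  then have "path_in red V (P @ [u])"
    using P red_sym by (auto simp: path_in_def successively_append_iff)
  then show False using red_le by fastforce
qed

text \<open>Otherwise \<open>u\<close> could be inserted into \<open>P\<close> between two
  consecutive red neighbours.\<close>

lemma outside_adj:
  assumes "u \<in> U"
  shows "successively (\<lambda>a b. \<not> red u a \<or> \<not> red u b) P"
proof (rule ccontr)
  assume "\<not> ?thesis"
  then obtain A x y D where *: "P = A @ [x, y] @ D" "red u x" "red u y"
    by (elim not_successivelyE) auto
  have "path_in red V (A @ [x, u, y] @ D)"
    using P assms *(2,3) red_sym[OF *(2)] unfolding *(1) path_in_def
    by (auto simp: successively_append_iff successively_Cons)
  then show False using red_le *(1) by fastforce
qed

section \<open>Parts meeting both \<open>P\<close> and \<open>U\<close>\<close>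

text \<open>Since \<open>w\<close> and \<open>u\<close> have the same red neighbours, a red pair
  \<open>u\<close>, \<open>u'\<close> could be inserted into \<open>P\<close> right after
  \<open>w\<close> in the order \<open>u'\<close>, \<open>u\<close>; if \<open>w\<close> is the last
  vertex, \<open>u'\<close> could be appended.\<close>

lemma mixed_no_red:
  assumes w: "w \<in> set P" "u \<in> U" "f u = f w" and u': "u' \<in> U"
  shows "\<not> red u u'"
proof
  assume r: "red u u'"
  have V: "w \<in> V" "u \<in> V" "u' \<in> V" using w u' PV by auto
  have wu': "red w u'" using r red_label[OF V(2,1) w(3)] by blast
  obtain A D where P': "P = A @ w # D" using w by (meson split_list)
  have ne: "u \<noteq> u'" using r red_cross by blast
  show False
  proof (cases D)
    case Nil
    have "path_in red V (A @ [w, u'])"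
      using P u' wu' unfolding path_in_def P' Nil
      by (auto simp: successively_append_iff successively_Cons)
    then show False using red_le P' Nil by fastforce
  next
    case (Cons z D')
    have "red w z" using succP unfolding P' Cons by (auto simp: successively_append_iff)
    then have "red u z" using red_label[OF V(2,1) w(3)] by blast
    then have "path_in red V (A @ [w, u', u, z] @ D')"
      using P u' w(2) wu' red_sym[OF r] ne unfolding path_in_def P' Cons
      by (auto simp: successively_append_iff successively_Cons)
    then show False using red_le P' Cons by fastforce
  qed
qed

text \<open>The vertices of \<open>P\<close> not red to \<open>u\<close> cover \<open>P\<close> and
  include its ends, so \<open>length P + 1 \<le> 2 * (card ?S + card ?T)\<close>. By balance the
  part has at most \<open>card ?R\<close> or at most \<open>length P / 2\<close> vertices; either
  bound leaves fewer than \<open>card ?T\<close> for \<open>?U1\<close>.\<close>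

lemma mixed_card:
  assumes w: "w \<in> set P" "u \<in> U" "f u = f w"
  shows "card {x \<in> U. f x = f u} < card {x \<in> set P. blue u x}"
proof -
  let ?S = "{x \<in> set P. f x = f u}" and ?T = "{x \<in> set P. blue u x}"
    and ?R = "{x \<in> set P. red u x}" and ?U1 = "{x \<in> U. f x = f u}"
  have V: "u \<in> V" using w by auto
  have "length P + 1 \<le> 2 * length (filter (\<lambda>x. \<not> red u x) P)"
    using outside_adj[OF w(2)] P(2) outside_hd[OF w(2)] outside_last[OF w(2)]
    by (rule cover_path)
  also have "length (filter (\<lambda>x. \<not> red u x) P) = card {x \<in> set P. \<not> red u x}"
    using distP by (rule length_filter_card)
  also have "{x \<in> set P. \<not> red u x} = ?S \<union> ?T" using red_cross by fastforce
  also have "card \<dots> = card ?S + card ?T" by (rule card_Un_disjoint) auto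
  finally have 1: "length P + 1 \<le> 2 * (card ?S + card ?T)" .
  have "set P = ?R \<union> (?S \<union> ?T)" by auto
  moreover have "card (?R \<union> (?S \<union> ?T)) = card ?R + card (?S \<union> ?T)"
    using red_cross by (intro card_Un_disjoint) fastforce+
  moreover have "card (?S \<union> ?T) = card ?S + card ?T" by (rule card_Un_disjoint) auto
  ultimately have 2: "length P = card ?R + card ?S + card ?T"
    using distinct_card[OF distP] by simp
  have "{y \<in> V. f y = f u} = ?S \<union> ?U1" using PV by auto
  moreover have "card (?S \<union> ?U1) = card ?S + card ?U1"
    using fin by (intro card_Un_disjoint) auto
  ultimately have 3: "card {y \<in> V. f y = f u} = card ?S + card ?U1" by simp
  have 4: "{y \<in> V. red u y} = ?R" using mixed_no_red[OF w] PV by auto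
  from balanced[OF V] show ?thesis
  proof
    assume "card {y \<in> V. f y = f u} \<le> card {y \<in> V. red u y}"
    then show ?thesis using 1 2 3 4 by simp
  next
    assume le: "card {y \<in> V. f y = f u} \<le> card {y \<in> V. blue u y}"
    \<comment> \<open>The blue neighbourhood is no smaller than the part, so interleaving the two
      gives a blue path on twice as many vertices as the part has.\<close>
    have "min (length ([] :: 'a list) + 2 * card {y \<in> V. f y = f u})
        (card {y \<in> V. blue u y} + card {y \<in> V. f y = f u})
        \<le> path_number blue ({y \<in> V. blue u y} \<union> {y \<in> V. f y = f u})"
    proof (rule join_path)
      fix x y assume "x \<in> {y \<in> V. blue u y}" "y \<in> {y \<in> V. f y = f u}"
      then show "blue x y \<and> blue y x"
        using red_label[of y u x] red_commute[of x y] V by auto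
    qed (use fin le in auto)
    also have "\<dots> \<le> path_number blue V" using fin by (intro path_number_mono) auto
    also have "\<dots> \<le> length P"
    proof -
      obtain xs where "path_in blue V xs" "length xs = path_number blue V"
        using path_number_attained[OF fin] .
      then show ?thesis using blue_le[of xs] by simp
    qed
    finally show ?thesis using 1 3 le by simp
  qed
qed

section \<open>Removing adjacent pairs of one part\<close>

text \<open>As \<open>s\<close> and \<open>t\<close> have the same blue neighbours, reversing the
  segment from \<open>t\<close> to \<open>z\<close> creates only blue junctions, \<open>s\<close>,
  \<open>z\<close> and \<open>t\<close>, \<open>hd D\<close>, and destroys the offending pair
  \<open>s\<close>, \<open>t\<close>.\<close>

lemma two_opt:
  assumes Q: "path_in link V Q" "Q = A @ [s] @ (t # M @ [z]) @ D" and st: "f s = f t"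
    and bz: "blue s z" and bD: "D = [] \<or> blue s (hd D)"
  shows "\<exists>Q'. path_in link V Q' \<and> inU Q' = inU Q \<and> inP Q' = inP Q \<and> count_adj sim Q' < count_adj sim Q"
proof (intro exI conjI)
  let ?K = "t # M @ [z]"
  let ?Q = "A @ [s] @ rev ?K @ D"
  have V: "s \<in> V" "t \<in> V" using Q by (auto simp: path_in_def)
  have "D = [] \<or> link t (hd D)"
    using bD red_label[OF V st] st by (auto simp: link_def)
  then show "path_in link V ?Q"
    using Q bz by (intro path_in_reverse_segment) (auto simp: link_def red_commute)
  show "inU ?Q = inU Q" "inP ?Q = inP Q" by (simp_all add: Q(2) rev_filter[symmetric])
  have "count_adj sim (A @ [s] @ ?K @ D) + of_bool (sim s z) + of_bool (D \<noteq> [] \<and> sim t (hd D))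
    = count_adj sim ?Q + of_bool (sim s t) + of_bool (D \<noteq> [] \<and> sim z (hd D))"
    using count_adj_reverse_segment[of ?K sim, OF _ eq_commute, of A s D] by (simp del: rev.simps append.simps)
  then show "count_adj sim ?Q < count_adj sim Q"
    using bz bD st unfolding Q(2) by (cases "D = []") (simp_all del: rev.simps append.simps count_adj.simps)
qed

lemma link_sym: "link x y \<Longrightarrow> link y x"
  by (auto simp: link_def dest: red_sym)

lemma alt_sym: "alt x y \<Longrightarrow> alt y x"
  by (auto simp: alt_def dest: red_sym)

lemma alt_link: "alt x y \<Longrightarrow> link x y"
  by (auto simp: alt_def link_def)

lemma length_inP_inU: "length Q = inP Q + inU Q"
  using sum_length_filter_compl[of "\<lambda>x. x \<in> set P" Q] by simp

text \<open>A blue neighbour of \<open>s\<close> that is followed by another one or by the end of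
  \<open>Q\<close> would be the far end of a segment to reverse.\<close>

lemma stuck_right:
  assumes Q: "path_in link V Q" "Q = A @ [s, t] @ D" "f s = f t"
    and stuck: "\<And>Q'. path_in link V Q' \<Longrightarrow> inU Q' = inU Q \<Longrightarrow> inP Q' = inP Q
      \<Longrightarrow> count_adj sim Q \<le> count_adj sim Q'"
  shows "successively (\<lambda>x y. \<not> blue s x \<or> \<not> blue s y) (t # D)" "\<not> blue s (last (t # D))"
proof -
  have no: False if "t # D = (t # M @ [z]) @ D'" "blue s z" "D' = [] \<or> blue s (hd D')" for M z D'
  proof -
    have "Q = A @ [s] @ (t # M @ [z]) @ D'" using Q(2) that(1) by simp
    from two_opt[OF Q(1) this Q(3) that(2,3)] show False
      using stuck by (metis not_le)
  qed
  show "successively (\<lambda>x y. \<not> blue s x \<or> \<not> blue s y) (t # D)"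
  proof (rule ccontr)
    assume "\<not> ?thesis"
    then obtain B x y D' where *: "t # D = B @ [x, y] @ D'" "blue s x" "blue s y"
      by (elim not_successivelyE) blast
    \<comment> \<open>The vertex \<open>t\<close> is in the part of \<open>s\<close> and so cannot
      be \<open>x\<close>.\<close>
    then obtain M where "B = t # M" using Q(3) by (cases B) auto
    then show False using no[of M x "y # D'"] * by simp
  qed
  show "\<not> blue s (last (t # D))"
  proof
    assume b: "blue s (last (t # D))"
    then have "D \<noteq> []" using Q(3) by auto
    then obtain M z where "D = M @ [z]" by (metis rev_exhaust)
    then show False using no[of M z "[]"] b by simp
  qed
qed

lemma count_rev: "count_adj sim (rev Q) = count_adj sim Q"
  by (rule count_adj_rev) auto

lemma filter_rev_length: "length (filter F (rev Q)) = length (filter F Q)"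
  by (simp add: rev_filter[symmetric])

text \<open>If no 2-opt move helps, then blue neighbours of \<open>s\<close> are neither adjacent on \<open>Q\<close> nor at its ends.\<close>
lemma stuck_cover:
  assumes Q: "path_in link V Q" "Q = A @ [s, t] @ D" "f s = f t"
    and stuck: "\<And>Q'. path_in link V Q' \<Longrightarrow> inU Q' = inU Q \<Longrightarrow> inP Q' = inP Q
      \<Longrightarrow> count_adj sim Q \<le> count_adj sim Q'"
  shows "length Q + 1 \<le> 2 * card {x \<in> set Q. \<not> blue s x}"
proof -
  let ?R = "\<lambda>x y. \<not> blue s x \<or> \<not> blue s y"
  have V: "s \<in> V" "t \<in> V" using Q by (auto simp: path_in_def)
  have st: "blue t x \<longleftrightarrow> blue s x" for x using red_label[OF V Q(3)] Q(3) by simp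
  note r = stuck_right[OF assms]
  \<comment> \<open>Reversal turns the pair into \<open>t\<close>, \<open>s\<close>. As
    \<open>t\<close> has the blue neighbours of \<open>s\<close>, this settles the half of
    \<open>Q\<close> up to \<open>s\<close>.\<close>
  have "path_in link V (rev Q)" using link_sym Q(1) by (rule path_in_rev)
  moreover have "rev Q = rev D @ [t, s] @ rev A" using Q(2) by simp
  moreover have "count_adj sim (rev Q) \<le> count_adj sim Q'"
    if "path_in link V Q'" "inU Q' = inU (rev Q)" "inP Q' = inP (rev Q)" for Q'
    using stuck[of Q'] that by (simp add: count_rev filter_rev_length)
  ultimately have l: "successively ?R (s # rev A)" "\<not> blue s (last (s # rev A))"
    using stuck_right[of "rev Q" "rev D" t s "rev A"] Q(3) unfolding st by auto
  have "successively ?R (rev (s # rev A))"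
    unfolding successively_rev by (rule successively_mono[OF l(1)]) blast
  then have 1: "successively ?R (A @ [s])" by simp
  have "Q = (A @ [s]) @ (t # D)" using Q(2) by simp
  then have "successively ?R Q"
    using 1 r(1) Q(3) by (simp add: successively_append_iff del: successively.simps append.simps append_assoc)
  moreover have "\<not> blue s (hd Q)" using l(2) Q(2) by (cases A) auto
  moreover have "\<not> blue s (last Q)" using r(2) Q(2) by auto
  moreover have "Q \<noteq> []" using Q(2) by simp
  ultimately have "length Q + 1 \<le> 2 * length (filter (\<lambda>x. \<not> blue s x) Q)"
    by (intro cover_path)
  then show ?thesis using Q(1) by (simp add: length_filter_card path_in_def)
qed

text \<open>The vertex \<open>b\<close> is blue to both \<open>s\<close> and \<open>t\<close>. If
  \<open>inP Q\<close> is \<alpha>, it is inserted between them; if it is \<alpha> + 1, then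
  \<open>t\<close> is dropped, or replaced by \<open>b\<close> when the next vertex is in the same
  part.\<close>

lemma exchange:
  assumes Q: "path_in link V Q" "Q = A @ [s, t] @ D" "f s = f t" and t: "t \<in> set P"
    and b: "b \<in> set P" "b \<notin> set Q" "blue s b" and Qp: "inP Q = \<alpha> \<or> inP Q = \<alpha> + 1"
  shows "\<exists>Q'. path_in link V Q' \<and> inU Q' = inU Q \<and> (inP Q' = \<alpha> \<or> inP Q' = \<alpha> + 1) \<and>
    count_adj sim Q' < count_adj sim Q"
proof -
  have V: "s \<in> V" "t \<in> V" "b \<in> V" using Q b PV by (auto simp: path_in_def)
  have st: "red t x \<longleftrightarrow> red s x" for x using red_label[OF V(1,2) Q(3)] by simp
  have bt: "blue t b" using b st Q(3) by simp
  have lk: "link s b" "link t b" using b bt by (auto simp: link_def)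
  then have lk: "link s b" "link b t" "link b s" using link_sym by auto
  have p: "distinct A" "distinct D" "s \<notin> set A" "s \<notin> set D" "t \<notin> set D" "set A \<inter> set D = {}"
     "set A \<subseteq> V" "set D \<subseteq> V" "b \<notin> set A" "b \<notin> set D" "b \<noteq> s" "b \<noteq> t" "s \<noteq> t" "t \<notin> set A"
    using Q(1) b unfolding Q(2) path_in_def by auto
  have "successively link ((A @ [s]) @ (t # D))" using Q(1) unfolding Q(2) path_in_def by simp
  then have sl: "successively link (A @ [s])" "link s t" "successively link (t # D)"
    unfolding successively_append_iff by auto
  have splice: "successively link (A @ s # E)" if "successively link (s # E)" for E
    using sl(1) that by (auto simp: successively_append_iff)
  show ?thesis
  proof (cases "inP Q = \<alpha>")
    case True
    let ?Q = "A @ [s, b, t] @ D"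
    have "path_in link V ?Q"
      using p V lk sl splice[of "b # t # D"] unfolding path_in_def by auto
    moreover have "inU ?Q = inU Q" "inP ?Q = inP Q + 1" using b(1) Q(2) by auto
    moreover have "count_adj sim ?Q < count_adj sim Q"
      using b(3) bt Q(3) unfolding Q(2) by (auto simp: count_adj_append)
    ultimately show ?thesis using True by (metis)
  next
    case False
    then have Qp: "inP Q = \<alpha> + 1" using Qp by simp
    show ?thesis
    proof (cases D)
      case Nil
      let ?Q = "A @ [s]"
      have "path_in link V ?Q" using p V sl unfolding path_in_def by auto
      moreover have "inU ?Q = inU Q" "inP ?Q = \<alpha>" using Qp t unfolding Q(2) Nil by auto
      moreover have "count_adj sim ?Q < count_adj sim Q"
        using Q(3) unfolding Q(2) Nil by (auto simp: count_adj_append)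
      ultimately show ?thesis by metis
    next
      case (Cons z D')
      have tz: "link t z" "successively link (z # D')" using sl Cons by auto
      show ?thesis
      proof (cases "f z = f t")
        case True
        \<comment> \<open>Dropping \<open>t\<close> alone would make \<open>s\<close> and
          \<open>z\<close> adjacent, two vertices of one part outside \<open>P\<close>, which
          \<open>link\<close> forbids.\<close>
        let ?Q = "A @ [s, b, z] @ D'"
        have z: "z \<notin> set P" "z \<in> V" using tz True t p Cons by (auto simp: link_def)
        have zb: "blue z b" using red_label[of t z b] True V z bt by auto
        have "link z b" using zb by (auto simp: link_def)
        then have "link b z" by (rule link_sym)
        then have "path_in link V ?Q"
          using p V lk tz splice[of "b # z # D'"] unfolding path_in_def Cons by auto
        moreover have "inU ?Q = inU Q" "inP ?Q = inP Q" using b(1) t unfolding Q(2) Cons by auto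
        moreover have "count_adj sim ?Q < count_adj sim Q"
          using b(3) zb Q(3) True unfolding Q(2) Cons by (auto simp: count_adj_append)
        ultimately show ?thesis using Qp by metis
      next
        case False
        let ?Q = "A @ [s, z] @ D'"
        have "link s z" using tz False st Q(3) by (auto simp: link_def)
        then have "path_in link V ?Q"
          using p V tz splice[of "z # D'"] unfolding path_in_def Cons by auto
        moreover have "inU ?Q = inU Q" "inP ?Q = \<alpha>" using Qp t unfolding Q(2) Cons by auto
        moreover have "count_adj sim ?Q < count_adj sim Q"
          using False Q(3) unfolding Q(2) Cons by (auto simp: count_adj_append)
        ultimately show ?thesis by metis
      qed
    qed
  qed
qed

text \<open>The slack of one vertex of \<^term>\<open>P\<close> lets a blue neighbour of \<open>s\<close> be inserted first and
  a vertex of \<^term>\<open>P\<close> be dropped later, so that every step needs only one offending pair.\<close>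
lemma repair_step:
  assumes Q: "path_in link V Q" and Qp: "inP Q = \<alpha> \<or> inP Q = \<alpha> + 1" and \<alpha>: "\<alpha> \<le> inU Q + 1"
    and pos: "0 < count_adj sim Q"
  shows "\<exists>Q'. path_in link V Q' \<and> inU Q' = inU Q \<and> (inP Q' = \<alpha> \<or> inP Q' = \<alpha> + 1) \<and>
    count_adj sim Q' < count_adj sim Q"
proof (rule ccontr)
  assume neg: "\<not> ?thesis"
  then have stuck: "count_adj sim Q \<le> count_adj sim Q'"
    if "path_in link V Q'" "inU Q' = inU Q" "inP Q' = inP Q" for Q'
    using that Qp by (metis not_le)
  obtain A s t D where Q': "Q = A @ [s, t] @ D" and st: "f s = f t"
    using pos count_adj_eq_0[of sim Q] by (metis (mono_tags, lifting) bot_nat_0.not_eq_extremum not_successivelyE)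
  have V: "s \<in> V" "t \<in> V" using Q Q' by (auto simp: path_in_def)
  have bst: "blue t x \<longleftrightarrow> blue s x" for x using red_label[OF V st] st by simp
  have "link s t" using Q unfolding Q' path_in_def by (auto simp: successively_append_iff)
  then have one: "(s \<in> set P) \<noteq> (t \<in> set P)" using st by (simp add: link_def)
  let ?T = "{x \<in> set P. blue s x}" and ?U1 = "{x \<in> U. f x = f s}"
  \<comment> \<open>An exchange would bring in a missing blue neighbour, on \<open>Q\<close> or on
    its reverse according to which of \<open>s\<close>, \<open>t\<close> lies on
    \<open>P\<close>.\<close>
  have T: "?T \<subseteq> set Q"
  proof
    fix b assume "b \<in> ?T"
    then have b: "b \<in> set P" "blue s b" "blue t b" using bst by auto
    show "b \<in> set Q"
    proof (rule ccontr)
      assume bQ: "b \<notin> set Q"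
      show False
      proof (cases "t \<in> set P")
        case True
        from exchange[OF Q Q' st True b(1) bQ b(2) Qp] neg show False by blast
      next
        case False
        then have s: "s \<in> set P" using one by simp
        have R: "path_in link V (rev Q)" using link_sym Q by (rule path_in_rev)
        have R': "rev Q = rev D @ [t, s] @ rev A" using Q' by simp
        have "b \<notin> set (rev Q)" "inP (rev Q) = \<alpha> \<or> inP (rev Q) = \<alpha> + 1"
          using bQ Qp by (simp_all add: filter_rev_length)
        from exchange[OF R R' st[symmetric] s b(1) this(1) b(3) this(2)] neg show False
          by (simp only: filter_rev_length count_rev)
      qed
    qed
  qed
  obtain w u where wu: "w \<in> set P" "u \<in> U" "f u = f w" "f u = f s"
    using one st V by (cases "s \<in> set P") auto
  have us: "red u x \<longleftrightarrow> red s x" for x using red_label[of u s x] wu V by auto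
  have lt: "card ?U1 < card ?T" using mixed_card[OF wu(1-3)] by (simp add: us wu(4))
  have "length Q + 1 \<le> 2 * card {x \<in> set Q. \<not> blue s x}"
    using Q Q' st stuck by (rule stuck_cover)
  moreover have "card {x \<in> set Q. \<not> blue s x} \<le> inP Q - card ?T + card ?U1"
  proof -
    \<comment> \<open>No vertex of \<open>U\<close> is red to \<open>s\<close>, so one that is not
      blue to \<open>s\<close> lies in its part.\<close>
    have "{x \<in> set Q. \<not> blue s x} \<subseteq> ({x \<in> set Q. x \<in> set P} - ?T) \<union> ?U1"
    proof
      fix x assume x: "x \<in> {x \<in> set Q. \<not> blue s x}"
      then have "x \<in> V" using Q by (auto simp: path_in_def)
      moreover have "\<not> red s x" if "x \<in> U" using mixed_no_red[OF wu(1-3) that] red_label[of u s x] wu V by auto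
      ultimately show "x \<in> ({x \<in> set Q. x \<in> set P} - ?T) \<union> ?U1" using x by auto
    qed
    then have "card {x \<in> set Q. \<not> blue s x} \<le> card (({x \<in> set Q. x \<in> set P} - ?T) \<union> ?U1)"
      using fin by (intro card_mono) auto
    also have "\<dots> \<le> card ({x \<in> set Q. x \<in> set P} - ?T) + card ?U1" by (rule card_Un_le)
    also have "card ({x \<in> set Q. x \<in> set P} - ?T) = inP Q - card ?T"
      using T Q by (subst card_Diff_subset) (auto simp: length_filter_card path_in_def)
    finally show ?thesis .
  qed
  moreover have "card ?T \<le> inP Q"
    using T Q by (auto simp: length_filter_card path_in_def intro!: card_mono)
  \<comment> \<open>From \<open>card ?U1 < card ?T\<close> follows
    \<open>length Q + 1 \<le> 2 * (inP Q - 1)\<close>, hence \<open>inU Q + 3 \<le> inP Q\<close>,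
    whereas \<open>inP Q \<le> \<alpha> + 1 \<le> inU Q + 2\<close>.\<close>
  ultimately show False using lt \<alpha> Qp length_inP_inU[of Q] by linarith
qed

text \<open>Repair steps lower \<open>count_adj sim\<close>, and at zero every link is blue. The
  steps keep \<open>inP\<close> only within \<alpha> and \<alpha> + 1, hence \<alpha> in the length
  bound.\<close>

lemma repair:
  assumes "path_in link V Q" "inP Q = \<alpha> \<or> inP Q = \<alpha> + 1" "\<alpha> \<le> inU Q + 1"
  shows "\<exists>Q'. path_in blue V Q' \<and> inU Q + \<alpha> \<le> length Q'"
  using assms
proof (induction "count_adj sim Q" arbitrary: Q rule: less_induct)
  case less
  show ?case
  proof (cases "count_adj sim Q = 0")
    case True
    then have "successively (\<lambda>x y. f x \<noteq> f y) Q" by (simp add: count_adj_eq_0)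
    moreover have "successively link Q" "set Q \<subseteq> V" "distinct Q" using less(2) by (auto simp: path_in_def)
    ultimately have "path_in blue V Q"
      unfolding path_in_def successively_conv_nth link_def by auto
    then show ?thesis using less(3) length_inP_inU[of Q] by (intro exI[of _ Q]) auto
  next
    case False
    then obtain Q' where "path_in link V Q'" "inU Q' = inU Q" "inP Q' = \<alpha> \<or> inP Q' = \<alpha> + 1"
      "count_adj sim Q' < count_adj sim Q"
      using repair_step[OF less(2-4)] by auto
    then show ?thesis using less(1)[of Q'] less(4) by simp
  qed
qed

section \<open>Alternating paths between \<open>P\<close> and \<open>U\<close>\<close>

text \<open>Alternation yields \<open>inP Q \<le> inU Q + 1\<close>, so \<open>repair\<close>
  applies with \<alpha> = \<open>inP Q\<close> and loses no length.\<close>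

lemma repair_alt:
  assumes "path_in alt V Q"
  shows "\<exists>Q'. path_in blue V Q' \<and> length Q \<le> length Q'"
proof (cases "Q = []")
  case False
  have "path_in link V Q" using assms alt_link by (rule path_in_mono[OF _ order_refl])
  moreover have "successively (\<lambda>x y. (x \<in> set P) \<noteq> (y \<in> set P)) Q"
    using assms by (auto simp: path_in_def alt_def elim!: successively_mono)
  from length_alternating[OF this False] have "inP Q \<le> inU Q + 1"
    using length_inP_inU[of Q] by (auto simp: of_bool_def split: if_splits)
  ultimately show ?thesis using repair[of Q "inP Q"] length_inP_inU[of Q] by (simp add: add.commute)
qed (auto intro: exI[of _ "[]"])

lemma alt_le:
  assumes "path_in alt V Q"
  shows "length Q \<le> length P"
  using repair_alt[OF assms] blue_le by force

lemma alt_ends: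
  assumes "path_in alt V Q" "Q \<noteq> []"
  shows "2 * inP Q + 1 = length Q + of_bool (hd Q \<in> set P) + of_bool (last Q \<in> set P)"
proof (rule length_alternating)
  show "successively (\<lambda>x y. (x \<in> set P) \<noteq> (y \<in> set P)) Q"
    using assms by (auto simp: path_in_def alt_def elim!: successively_mono)
qed fact

text \<open>If \<open>Q\<close> met every edge and both ends of \<open>P\<close>, it would contain
  more than half of the vertices of \<open>P\<close>.\<close>

lemma uncovered:
  assumes Q: "path_in alt V Q" and le: "2 * inP Q \<le> length P"
  shows "hd P \<notin> set Q \<or> last P \<notin> set Q \<or> \<not> successively (\<lambda>a b. a \<in> set Q \<or> b \<in> set Q) P"
proof (rule ccontr)
  assume "\<not> ?thesis"
  then have "length P + 1 \<le> 2 * length (filter (\<lambda>x. x \<in> set Q) P)"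
    using P(2) by (intro cover_path) auto
  also have "length (filter (\<lambda>x. x \<in> set Q) P) = inP Q"
    using distP Q by (simp add: length_filter_card path_in_def conj_commute)
  finally show False using le by simp
qed

text \<open>\<open>Q\<close> misses an end or an edge of \<open>P\<close>, and \<open>u\<close> is
  not red to either end nor to both vertices of an edge.\<close>

lemma free_neighbour:
  assumes Q: "path_in alt V Q" and le: "2 * inP Q \<le> length P" and u: "u \<in> U"
  shows "\<exists>w\<in>set P - set Q. alt u w"
proof -
  have "\<exists>w\<in>set P - set Q. \<not> red u w"
    using uncovered[OF Q le]
  proof (elim disjE)
    assume "\<not> successively (\<lambda>a b. a \<in> set Q \<or> b \<in> set Q) P"
    then obtain A x y D where *: "P = A @ [x, y] @ D" "x \<notin> set Q" "y \<notin> set Q"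
      by (elim not_successivelyE) auto
    have "\<not> red u x \<or> \<not> red u y"
      using outside_adj[OF u] unfolding *(1) by (auto simp: successively_append_iff)
    then show ?thesis using * by auto
  next
    assume "hd P \<notin> set Q"
    then show ?thesis using P(2) outside_hd[OF u] by (intro bexI[of _ "hd P"]) auto
  next
    assume "last P \<notin> set Q"
    then show ?thesis using P(2) outside_last[OF u] by (intro bexI[of _ "last P"]) auto
  qed
  then show ?thesis using u by (auto simp: alt_def)
qed

lemma path_in_Cons:
  "path_in E V (x # Q) \<longleftrightarrow> x \<in> V \<and> x \<notin> set Q \<and> path_in E V Q \<and> (Q = [] \<or> E x (hd Q))"
  by (cases Q) (auto simp: path_in_def)

lemma path_in_snoc:
  "path_in E V (Q @ [x]) \<longleftrightarrow> x \<in> V \<and> x \<notin> set Q \<and> path_in E V Q \<and> (Q = [] \<or> E (last Q) x)"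
  by (auto simp: path_in_def successively_append_iff)

text \<open>A longest alternating path with both ends in \<^term>\<open>U\<close> exhausts \<^term>\<open>U\<close>: if \<open>u\<close> is missing,
  then \<^term>\<open>hd P\<close> lies on the path and some edge of \<^term>\<open>P\<close> avoids it; one end of this edge closes
  the path to a cycle, which can be opened at \<^term>\<open>hd P\<close> and extended by \<open>u\<close>.\<close>
lemma exhausting_path:
  assumes "U \<noteq> {}"
  shows "\<exists>Q. path_in alt V Q \<and> Q \<noteq> [] \<and> hd Q \<in> U \<and> last Q \<in> U \<and> U \<subseteq> set Q"
proof -
  define good where "good Q \<longleftrightarrow> path_in alt V Q \<and> Q \<noteq> [] \<and> hd Q \<in> U \<and> last Q \<in> U" for Q
  obtain u0 where u0: "u0 \<in> U" using assms by auto
  have "good [u0]" using u0 by (simp add: good_def path_in_def)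
  moreover have "\<forall>Q. good Q \<longrightarrow> length Q \<le> length P" using alt_le by (auto simp: good_def)
  ultimately obtain Q where Q: "good Q" and max: "\<And>Q'. good Q' \<Longrightarrow> length Q' \<le> length Q"
    using ex_has_greatest_nat[of good "[u0]" length "Suc (length P)"] by (auto simp: less_Suc_eq_le)
  have pQ: "path_in alt V Q" "Q \<noteq> []" "hd Q \<in> U" "last Q \<in> U" using Q by (auto simp: good_def)
  have le: "2 * inP Q \<le> length P"
    using alt_ends[OF pQ(1,2)] alt_le[OF pQ(1)] pQ(3,4) by simp
  have "U \<subseteq> set Q"
  proof
    fix u assume u: "u \<in> U"
    show "u \<in> set Q"
    proof (rule ccontr)
      assume uQ: "u \<notin> set Q"
      have no: "red u w" if w: "w \<in> set P" "w \<notin> set Q" "\<not> red (hd Q) w" for w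
      proof (rule ccontr)
        assume "\<not> red u w"
        then have "alt u w" "alt (hd Q) w" using u w pQ(3) by (auto simp: alt_def)
        then have "alt u w" "alt w (hd Q)" using alt_sym by auto
        then have "good (u # w # Q)"
          using w u uQ pQ PV by (auto simp: good_def path_in_Cons)
        then show False using max by fastforce
      qed
      have no': "red u w" if w: "w \<in> set P" "w \<notin> set Q" "\<not> red (last Q) w" for w
      proof (rule ccontr)
        assume "\<not> red u w"
        then have "alt u w" "alt (last Q) w" using u w pQ(4) by (auto simp: alt_def)
        then have "alt w u" "alt (last Q) w" using alt_sym by auto
        then have "good (Q @ [w, u])"
          using w u uQ pQ PV path_in_snoc[of alt "Q @ [w]" u] by (auto simp: good_def path_in_snoc)
        then show False using max by fastforce
      qed
      have xQ: "hd P \<in> set Q"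
        using no[of "hd P"] P(2) outside_hd[OF u] outside_hd[OF pQ(3)] by auto
      have "last P \<in> set Q"
        using no[of "last P"] P(2) outside_last[OF u] outside_last[OF pQ(3)] by auto
      then have "\<not> successively (\<lambda>a b. a \<in> set Q \<or> b \<in> set Q) P"
        using uncovered[OF pQ(1) le] xQ by auto
      then obtain A a b D where ab: "P = A @ [a, b] @ D" "a \<notin> set Q" "b \<notin> set Q"
        by (elim not_successivelyE) auto
      have nr: "\<not> red v a \<or> \<not> red v b" if "v \<in> U" for v
        using outside_adj[OF that] unfolding ab(1) by (auto simp: successively_append_iff)
      \<comment> \<open>One of \<open>a\<close>, \<open>b\<close> is not red to \<open>u\<close>. By
        \<open>no\<close> and \<open>no'\<close> both ends of \<open>Q\<close> are red to it, hence
        not red to the other one, which serves as \<open>c\<close>.\<close>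
      have "\<exists>c. c \<in> set P \<and> c \<notin> set Q \<and> \<not> red (hd Q) c \<and> \<not> red (last Q) c"
        using nr[OF u] nr[OF pQ(3)] nr[OF pQ(4)] no[of a] no[of b] no'[of a] no'[of b] ab
        by auto
      then obtain c where c: "c \<in> set P" "c \<notin> set Q" "\<not> red (hd Q) c" "\<not> red (last Q) c" by auto
      obtain Q1 Q2 where Q12: "Q = Q1 @ hd P # Q2" using xQ by (meson split_list)
      have xU: "hd P \<notin> U" "hd P \<in> set P" using P(2) by auto
      have ne: "Q1 \<noteq> []" "Q2 \<noteq> []" using pQ(3,4) xU(1) unfolding Q12 by auto
      \<comment> \<open>Going through \<open>c\<close> closes \<open>Q\<close> to a cycle. Cut just
        before \<open>hd P\<close> it ends in the predecessor \<open>last Q1\<close>, and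
        \<open>u\<close> is attached in front: two vertices more than \<open>Q\<close>.\<close>
      let ?Q = "[u, hd P] @ Q2 @ [c] @ Q1"
      have s: "successively alt Q1" "successively alt (hd P # Q2)"
        using pQ(1) unfolding Q12 path_in_def by (auto simp: successively_append_iff)
      have "alt u (hd P)" using u xU outside_hd[OF u] by (auto simp: alt_def)
      moreover have "alt (last Q2) c" using c pQ(4) ne unfolding Q12 by (auto simp: alt_def)
      moreover have "alt (hd Q1) c" using c(1,3) pQ(3) ne unfolding Q12 by (auto simp: alt_def)
      then have "alt c (hd Q1)" by (rule alt_sym)
      ultimately have "successively alt ?Q"
        using s ne by (auto simp: successively_append_iff successively_Cons hd_append)
      moreover have "distinct ?Q" "set ?Q \<subseteq> V"
        using pQ(1) uQ u c PV unfolding Q12 path_in_def by auto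
      moreover have "last ?Q \<in> U"
      proof -
        have "successively alt (Q1 @ [hd P])"
          using pQ(1) unfolding Q12 path_in_def by (auto simp: successively_append_iff)
        then have "alt (last Q1) (hd P)" using ne by (auto simp: successively_append_iff)
        then have "last Q1 \<notin> set P" using xU by (auto simp: alt_def)
        moreover have "last Q1 \<in> V" using pQ(1) ne unfolding Q12 path_in_def by auto
        ultimately show ?thesis using ne by simp
      qed
      ultimately have "good ?Q" using u by (auto simp: good_def path_in_def)
      then have "length ?Q \<le> length Q" by (rule max)
      then show False using Q12 by simp
    qed
  qed
  then show ?thesis using pQ by auto
qed

text \<open>An alternating path through all of \<open>U\<close> with both ends in \<open>U\<close>
  has \<open>2 * card U - 1\<close> vertices. A free vertex of \<open>P\<close> is added at each
  end, and the repair does not shorten the result.\<close>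

theorem long_blue_path:
  "\<exists>Q. path_in blue V Q \<and> 2 * card U + 1 \<le> length Q"
proof (cases "U = {}")
  case True
  have "path_in blue V [hd P]" using P(2) PV by (auto simp: path_in_def)
  then show ?thesis unfolding True by force
next
  case False
  obtain Q where Q: "path_in alt V Q" "Q \<noteq> []" "hd Q \<in> U" "last Q \<in> U" "U \<subseteq> set Q"
    using exhausting_path[OF False] by auto
  have "2 * inP Q \<le> length P" using alt_ends[OF Q(1,2)] alt_le[OF Q(1)] Q(3,4) by simp
  then obtain w where w: "w \<in> set P" "w \<notin> set Q" "alt (hd Q) w"
    using free_neighbour[OF Q(1) _ Q(3)] by auto
  have wQ: "path_in alt V (w # Q)" using w Q(1) PV alt_sym by (auto simp: path_in_Cons)
  \<comment> \<open>Exactly one end now lies on \<open>P\<close>, so the left side equals the length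
    of \<open>w # Q\<close>, bounded by \<open>alt_le\<close>.\<close>
  have "2 * inP (w # Q) \<le> length P"
    using alt_ends[OF wQ] alt_le[OF wQ] Q(2,4) w by simp
  then obtain w' where w': "w' \<in> set P" "w' \<notin> set (w # Q)" "alt (last Q) w'"
    using free_neighbour[OF wQ _ Q(4)] by auto
  have wQw: "path_in alt V ((w # Q) @ [w'])"
    using w' wQ Q(2) PV by (subst path_in_snoc) auto
  have "card U \<le> inU Q"
    using Q(1,5) by (auto simp: length_filter_card path_in_def intro!: card_mono)
  moreover have "length Q + 1 = 2 * inU Q"
    using alt_ends[OF Q(1,2)] Q(3,4) length_inP_inU[of Q] by simp
  ultimately have "2 * card U + 1 \<le> length ((w # Q) @ [w'])" by simp
  then show ?thesis using repair_alt[OF wQw] le_trans by blast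
qed

end

section \<open>Gallai partitions\<close>

definition gallai_on :: "'a set \<Rightarrow> ('a \<Rightarrow> 'a \<Rightarrow> 'c) \<Rightarrow> bool" where
  "gallai_on V c \<longleftrightarrow> (\<forall>x\<in>V. \<forall>y\<in>V. \<forall>z\<in>V. x \<noteq> y \<longrightarrow> y \<noteq> z \<longrightarrow> x \<noteq> z \<longrightarrow>
     c x y = c y z \<or> c y z = c x z \<or> c x y = c x z)"

definition module_labelling :: "'a set \<Rightarrow> ('a \<Rightarrow> 'a \<Rightarrow> 'c) \<Rightarrow> ('a \<Rightarrow> 'b) \<Rightarrow> bool" where
  "module_labelling V c f \<longleftrightarrow> (\<forall>x\<in>V. \<forall>x'\<in>V. \<forall>y\<in>V. f x = f x' \<longrightarrow> f y \<noteq> f x \<longrightarrow> c x y = c x' y)"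

text \<open>Every modular partition is trivial: one part or only singletons. Label types cannot be
  quantified inside a definition; \<open>'a set\<close> suffices, as parts can label
  themselves.\<close>

definition prime_coloring :: "'a set \<Rightarrow> ('a \<Rightarrow> 'a \<Rightarrow> 'c) \<Rightarrow> bool" where
  "prime_coloring V c \<longleftrightarrow>
     (\<forall>f :: 'a \<Rightarrow> 'a set. module_labelling V c f \<longrightarrow> 2 \<le> card (f ` V) \<longrightarrow> inj_on f V)"

lemma gallai_on_subset: "gallai_on V c \<Longrightarrow> W \<subseteq> V \<Longrightarrow> gallai_on W c"
  unfolding gallai_on_def by blast

lemma two_le_card: "finite A \<Longrightarrow> x \<in> A \<Longrightarrow> y \<in> A \<Longrightarrow> x \<noteq> y \<Longrightarrow> 2 \<le> card A"
  using card_mono[of A "{x, y}"] by simp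

text \<open>If the edges of a colour do not cross the cut \<open>X\<close>, then its components form modules.\<close>
lemma prime_crossing:
  assumes fin: "finite V" and sym: "\<And>x y. c x y = c y x" and gal: "gallai_on V c"
    and prime: "prime_coloring V c"
    and pq: "p \<in> V" "q \<in> V" "p \<noteq> q" and X: "X \<subseteq> V" "X \<noteq> {}" "X \<noteq> V"
  shows "\<exists>x\<in>X. \<exists>y\<in>V - X. c x y = c p q"
proof (rule ccontr)
  assume neg: "\<not> ?thesis"
  define E where "E = {(x, y). x \<in> V \<and> y \<in> V \<and> x \<noteq> y \<and> c x y = c p q}"
  define f where "f x = E\<^sup>* `` {x}" for x
  have symE: "sym (E\<^sup>*)" by (rule sym_rtrancl) (auto simp: E_def sym_def sym)
  have f: "f x = f y \<longleftrightarrow> (x, y) \<in> E\<^sup>*" for x y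
  proof
    assume "f x = f y"
    then have "(y, x) \<in> E\<^sup>*" unfolding f_def by auto
    then show "(x, y) \<in> E\<^sup>*" using symE by (auto dest: symD)
  next
    assume "(x, y) \<in> E\<^sup>*"
    then show "f x = f y" unfolding f_def using symE by (auto dest: symD intro: rtrancl_trans)
  qed
  have "module_labelling V c f"
    unfolding module_labelling_def
  proof (intro ballI impI)
    fix x x' y assume "x \<in> V" "x' \<in> V" and y: "y \<in> V" and "f x = f x'" "f y \<noteq> f x"
    then have "(x, x') \<in> E\<^sup>*" "(x, y) \<notin> E\<^sup>*" using f[of x x'] f[of x y] by auto
    then show "c x y = c x' y"
    proof (induction rule: rtrancl_induct)
      case (step v w)
      have vw: "v \<in> V" "w \<in> V" "v \<noteq> w" "c v w = c p q" using step by (auto simp: E_def)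
      have ny: "(v, y) \<notin> E\<^sup>*" "(w, y) \<notin> E\<^sup>*" using step by (meson rtrancl.simps rtrancl_trans)+
      then have ne: "v \<noteq> y" "w \<noteq> y" by auto
      have "c v y \<noteq> c p q" "c w y \<noteq> c p q" using ny vw ne y by (auto simp: E_def)
      \<comment> \<open>The edge \<open>v\<close>, \<open>w\<close> has the colour
        \<open>c p q\<close> and the other two edges of the triangle do not, so these agree.\<close>
      then have "c v y = c w y" using gal vw ne y unfolding gallai_on_def by metis
      then show ?case using step by simp
    qed simp
  qed
  moreover have "2 \<le> card (f ` V)"
  proof -
    obtain x y where xy: "x \<in> X" "y \<in> V" "y \<notin> X" using X by auto
    have "(x, z) \<in> E\<^sup>* \<Longrightarrow> z \<in> X" for z
    proof (induction rule: rtrancl_induct)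
      case (step v w)
      then show ?case using neg by (auto simp: E_def)
    qed (use xy in simp)
    then have "f x \<noteq> f y" using f xy by auto
    then show ?thesis using xy X fin by (intro two_le_card) auto
  qed
  ultimately have "inj_on f V" using prime unfolding prime_coloring_def by blast
  moreover have "f p = f q" using f pq by (auto simp: E_def)
  ultimately show False using pq by (auto dest: inj_onD)
qed

section \<open>Coarsest modular partitions\<close>

lemma coarsest_labelling:
  assumes "finite V" "2 \<le> card V"
  obtains f :: "'a \<Rightarrow> 'a set" where "module_labelling V c f" "2 \<le> card (f ` V)"
    "\<And>g :: 'a \<Rightarrow> 'a set. module_labelling V c g \<Longrightarrow> 2 \<le> card (g ` V) \<Longrightarrow> card (f ` V) \<le> card (g ` V)"
proof -
  define ok where "ok f \<longleftrightarrow> module_labelling V c f \<and> 2 \<le> card (f ` V)" for f :: "'a \<Rightarrow> 'a set"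
  have "ok (\<lambda>x. {x})"
    using assms by (auto simp: ok_def module_labelling_def card_image)
  then obtain f where "ok f" "\<forall>g. ok g \<longrightarrow> card (f ` V) \<le> card (g ` V)"
    using ex_has_least_nat[of ok "\<lambda>x. {x}" "\<lambda>f. card (f ` V)"] by auto
  then show ?thesis using that by (auto simp: ok_def)
qed

text \<open>A modular labelling of \<open>T\<close> pulls back along representatives to one of
  \<open>V\<close> with the same number of labels. By minimality it has at least
  \<open>card T\<close> labels, so it is injective on \<open>T\<close>.\<close>

lemma transversal_prime:
  fixes f :: "'a \<Rightarrow> 'a set"
  assumes fin: "finite V" and sym: "\<And>x y. c x y = c y x" and f: "module_labelling V c f"
    and min: "\<And>g :: 'a \<Rightarrow> 'a set. module_labelling V c g \<Longrightarrow> 2 \<le> card (g ` V) \<Longrightarrow> card (f ` V) \<le> card (g ` V)"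
    and T: "T \<subseteq> V" "inj_on f T" "f ` T = f ` V"
  shows "prime_coloring T c"
  unfolding prime_coloring_def
proof (intro allI impI)
  fix g :: "'a \<Rightarrow> 'a set" assume g: "module_labelling T c g" "2 \<le> card (g ` T)"
  define rep where "rep x = inv_into T f (f x)" for x
  have rep: "rep x \<in> T" "f (rep x) = f x" if "x \<in> V" for x
    using inv_into_into[of "f x" f T] f_inv_into_f[of "f x" f T] that T(3) by (simp_all add: rep_def)
  have repT: "rep x = x" if "x \<in> T" for x
    using inv_into_f_f[OF T(2) that] by (simp add: rep_def)
  have repc: "c x y = c (rep x) (rep y)" if "x \<in> V" "y \<in> V" "f x \<noteq> f y" for x y
  proof -
    have "c x y = c (rep x) y"
      using f that rep[OF that(1)] T(1) unfolding module_labelling_def by (metis subsetD)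
    also have "\<dots> = c y (rep x)" by (rule sym)
    also have "\<dots> = c (rep y) (rep x)"
      using f that rep[OF that(1)] rep[OF that(2)] T(1) unfolding module_labelling_def by (metis subsetD)
    finally show ?thesis by (simp add: sym)
  qed
  have "module_labelling V c (\<lambda>x. g (rep x))"
    unfolding module_labelling_def
  proof (intro ballI impI)
    fix x x' y assume V: "x \<in> V" "x' \<in> V" "y \<in> V" and h: "g (rep x) = g (rep x')" "g (rep y) \<noteq> g (rep x)"
    have "f y \<noteq> f x" "f y \<noteq> f x'" using h unfolding rep_def by auto
    then have "c x y = c (rep x) (rep y)" "c x' y = c (rep x') (rep y)" using V by (auto intro: repc)
    moreover have "c (rep x) (rep y) = c (rep x') (rep y)"
      using g(1) V h rep(1) unfolding module_labelling_def by blast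
    ultimately show "c x y = c x' y" by simp
  qed
  moreover have "rep ` V = T" using rep repT T(1) by force
  then have im: "(\<lambda>x. g (rep x)) ` V = g ` T" by (metis image_image)
  ultimately have "card (f ` V) \<le> card (g ` T)" using min[of "\<lambda>x. g (rep x)"] g(2) by simp
  moreover have "card (f ` V) = card T" using T card_image by metis
  moreover have "finite T" using fin T(1) by (rule finite_subset[rotated])
  ultimately show "inj_on g T" using card_image_le[of T g] by (intro eq_card_imp_inj_on) auto
qed

text \<open>Delete a vertex \<open>v\<close>. By induction on a transversal, the coarsest partition
  of the rest has two colours \<open>a\<close>, \<open>b\<close> between its parts. A further colour
  \<open>j\<close> must go from \<open>v\<close> into every part, and the triangles at
  \<open>v\<close> then limit the colours at \<open>v\<close>, where every colour has to
  occur.\<close>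

lemma prime_two_colors:
  assumes "finite V" "\<And>x y. c x y = c y x" "gallai_on V c" "prime_coloring V c" "2 \<le> card V"
  shows "\<exists>a b. \<forall>x\<in>V. \<forall>y\<in>V. x \<noteq> y \<longrightarrow> c x y = a \<or> c x y = b"
  using assms
proof (induction "card V" arbitrary: V rule: less_induct)
  case less
  note fin = less.prems(1) and sym = less.prems(2) and gal = less.prems(3) and prime = less.prems(4)
  obtain v where v: "v \<in> V" using less.prems(5) by fastforce
  define W where "W = V - {v}"
  have W: "W \<subseteq> V" "finite W" "v \<notin> W" "card W = card V - 1" "V = insert v W"
    using v fin by (auto simp: W_def)
  show ?case
  proof (cases "card W \<le> 1")
    case True
    then have "card W = 1" using W(4) less.prems(5) by linarith
    then obtain w where "W = {w}" by (auto simp: card_1_singleton_iff)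
    then have "V = {v, w}" using W(5) by simp
    then have "\<forall>x\<in>V. \<forall>y\<in>V. x \<noteq> y \<longrightarrow> c x y = c v w \<or> c x y = c v w"
      using sym[of w v] by auto
    then show ?thesis by blast
  next
    case False
    then have "2 \<le> card W" by simp
    then obtain f :: "'a \<Rightarrow> 'a set" where f: "module_labelling W c f" "2 \<le> card (f ` W)"
      "\<And>g :: 'a \<Rightarrow> 'a set. module_labelling W c g \<Longrightarrow> 2 \<le> card (g ` W) \<Longrightarrow> card (f ` W) \<le> card (g ` W)"
      using coarsest_labelling[OF W(2)] by metis
    obtain T where T: "T \<subseteq> W" "inj_on f T" "f ` T = f ` W"
      using subset_image_inj[of "f ` W" f W] by auto
    have finT: "finite T" using T(1) W(2) by (rule finite_subset)
    have primeT: "prime_coloring T c" using transversal_prime[OF W(2) sym f(1) f(3) T] .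
    have galT: "gallai_on T c" using gal T(1) W(1) by (metis gallai_on_subset subset_trans)
    have cT: "2 \<le> card T" using f(2) T by (metis card_image)
    have "card T < card V" using card_mono[OF W(2) T(1)] W(4) less.prems(5) by simp
    then obtain a b where abT: "\<forall>x\<in>T. \<forall>y\<in>T. x \<noteq> y \<longrightarrow> c x y = a \<or> c x y = b"
      using less.hyps[OF _ finT sym galT primeT cT] by blast
    have toT: "\<exists>t\<in>T. f t = f x" if "x \<in> W" for x
    proof -
      have "f x \<in> f ` T" using that T(3) by auto
      then show ?thesis by force
    qed
    have cc: "c x y = c x' y'" if "x \<in> W" "y \<in> W" "x' \<in> W" "y' \<in> W" "f x = f x'" "f y = f y'" "f x \<noteq> f y"
      for x y x' y'
    proof -
      have "c x y = c x' y" using f(1) that unfolding module_labelling_def by metis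
      also have "\<dots> = c y x'" by (rule sym)
      also have "\<dots> = c y' x'" using f(1) that unfolding module_labelling_def by metis
      finally show ?thesis by (simp add: sym)
    qed
    have ab: "c x y = a \<or> c x y = b" if xy: "x \<in> W" "y \<in> W" "f x \<noteq> f y" for x y
    proof -
      obtain s t where st: "s \<in> T" "t \<in> T" "f s = f x" "f t = f y" using toT xy by metis
      then have "c x y = c s t" using cc xy T(1) by (metis subsetD)
      moreover have "s \<noteq> t" using st xy by auto
      ultimately show ?thesis using abT st by auto
    qed
    show ?thesis
    proof (cases "\<forall>x\<in>V. \<forall>y\<in>V. x \<noteq> y \<longrightarrow> c x y = a \<or> c x y = b")
      case True
      then show ?thesis by blast
    next
      case False
      then obtain p q where pq: "p \<in> V" "q \<in> V" "p \<noteq> q" "c p q \<noteq> a" "c p q \<noteq> b" by auto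
      define j where "j = c p q"
      have cross: "\<exists>x\<in>X. \<exists>y\<in>V - X. c x y = c p' q'"
        if "p' \<in> V" "q' \<in> V" "p' \<noteq> q'" "X \<subseteq> V" "X \<noteq> {}" "X \<noteq> V" for p' q' X
        using prime_crossing[OF fin sym gal prime that] .
      have atv: "\<exists>y\<in>W. c v y = c p' q'" if "p' \<in> V" "q' \<in> V" "p' \<noteq> q'" for p' q'
        using cross[OF that, of "{v}"] v False W(2,5) \<open>2 \<le> card W\<close> by auto
      \<comment> \<open>The cut around the part of \<open>x\<close> is crossed in colour
        \<open>j\<close>. Within \<open>W\<close> only \<open>a\<close> and \<open>b\<close> cross
        it, so the crossing edge ends in \<open>v\<close>.\<close>
      have jnb: "\<exists>y\<in>W. f y = f x \<and> c v y = j" if x: "x \<in> W" for x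
      proof -
        let ?X = "{y \<in> W. f y = f x}"
        have "\<exists>y\<in>?X. \<exists>z\<in>V - ?X. c y z = j"
          unfolding j_def using x v W pq by (intro cross) auto
        then obtain y z where yz: "y \<in> W" "f y = f x" "z \<in> V" "z \<notin> ?X" "c y z = j" by auto
        have "z = v"
        proof (rule ccontr)
          assume "z \<noteq> v"
          then have "z \<in> W" "f y \<noteq> f z" using yz W by auto
          then show False using ab[of y z] yz pq by (auto simp: j_def)
        qed
        then show ?thesis using yz sym by metis
      qed
      \<comment> \<open>Apply the Gallai condition to \<open>v\<close>, \<open>x\<close> and a
        \<open>j\<close>-neighbour \<open>y'\<close> of \<open>v\<close> in the part of
        \<open>y\<close>.\<close>
      have vx: "c v x = j \<or> c v x = c x y" if xy: "x \<in> W" "y \<in> W" "f x \<noteq> f y" for x y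
      proof -
        obtain y' where y': "y' \<in> W" "f y' = f y" "c v y' = j" using jnb xy by blast
        have e: "c x y' = c x y" using cc[of x y' x y] xy y' by simp
        then have "c x y' \<noteq> j" using ab[OF xy] pq by (auto simp: j_def)
        moreover have "v \<noteq> x" "v \<noteq> y'" "x \<noteq> y'" using xy y' W by auto
        ultimately show ?thesis
          using gal v W(1) xy(1) y' e unfolding gallai_on_def by (metis subsetD)
      qed
      have other: "\<exists>y\<in>W. f x \<noteq> f y" if "x \<in> W" for x
      proof (rule ccontr)
        assume "\<not> ?thesis"
        then have "f ` W \<subseteq> {f x}" by auto
        then have "card (f ` W) \<le> 1" using card_mono[of "{f x}"] by simp
        then show False using f(2) by simp
      qed
      show ?thesis
      proof (cases "\<exists>\<alpha>. \<forall>x\<in>W. \<forall>y\<in>W. f x \<noteq> f y \<longrightarrow> c x y = \<alpha>")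
        case True
        then obtain \<alpha> where \<alpha>: "\<forall>x\<in>W. \<forall>y\<in>W. f x \<noteq> f y \<longrightarrow> c x y = \<alpha>" by auto
        have "c v x = j \<or> c v x = \<alpha>" if "x \<in> W" for x
          using vx[OF that] other[OF that] \<alpha> that by metis
        then have "\<forall>x\<in>V. \<forall>y\<in>V. x \<noteq> y \<longrightarrow> c x y = j \<or> c x y = \<alpha>"
          using atv by metis
        then show ?thesis by blast
      next
        case False
        have nbr: "\<exists>y\<in>W. f x \<noteq> f y \<and> c x y = e"
          if e: "\<exists>p\<in>W. \<exists>q\<in>W. f p \<noteq> f q \<and> c p q = e" and x: "x \<in> W" for e x
        proof -
          obtain p' q' where pq': "p' \<in> W" "q' \<in> W" "f p' \<noteq> f q'" "c p' q' = e" using e by auto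
          obtain s t where st: "s \<in> T" "t \<in> T" "f s = f p'" "f t = f q'" using toT pq' by metis
          then have cst: "c s t = e" using cc[of s t p' q'] pq' T(1) by auto
          obtain r where r: "r \<in> T" "f r = f x" using toT x by blast
          have "\<exists>x\<in>{r}. \<exists>y\<in>T - {r}. c x y = c s t"
            using r st pq' cT by (intro prime_crossing[OF finT sym galT primeT]) auto
          then obtain y where y: "y \<in> T" "y \<noteq> r" "c r y = e" using cst by auto
          have "f r \<noteq> f y" using T(2) r y by (auto dest: inj_onD)
          then have "c x y = e" using cc[of x y r y] r y x T(1) by auto
          then show ?thesis using y r T(1) \<open>f r \<noteq> f y\<close> by auto
        qed
        have ne: "\<exists>p\<in>W. \<exists>q\<in>W. f p \<noteq> f q \<and> c p q = a" "\<exists>p\<in>W. \<exists>q\<in>W. f p \<noteq> f q \<and> c p q = b"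
          using False ab by metis+
        have aneb: "a \<noteq> b" using False ab by metis
        \<comment> \<open>\<open>x\<close> has neighbours of both colours \<open>a\<close> and
          \<open>b\<close> in other parts, so by \<open>vx\<close> only \<open>j\<close> is
          possible. But then \<open>a\<close> does not occur at \<open>v\<close>, against
          \<open>atv\<close>.\<close>
        have all: "c v x = j" if "x \<in> W" for x
          using vx[OF that] nbr[OF ne(1) that] nbr[OF ne(2) that] aneb that by metis
        obtain p' q' where pq': "p' \<in> W" "q' \<in> W" "f p' \<noteq> f q'" "c p' q' = a" using ne(1) by auto
        then have "\<exists>y\<in>W. c v y = c p' q'" using W(1) by (intro atv) auto
        then show ?thesis using all pq' pq by (auto simp: j_def)
      qed
    qed
  qed
qed

text \<open>A transversal of a coarsest partition is prime, hence two-coloured; modularity carries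
  this over to all pairs of vertices in different parts.\<close>

theorem gallai_partition:
  fixes c :: "'a \<Rightarrow> 'a \<Rightarrow> 'c"
  assumes fin: "finite V" and sym: "\<And>x y. c x y = c y x" and gal: "gallai_on V c" and two: "2 \<le> card V"
  shows "\<exists>(f :: 'a \<Rightarrow> 'a set) a b. module_labelling V c f \<and> 2 \<le> card (f ` V) \<and>
    (\<forall>x\<in>V. \<forall>y\<in>V. f x \<noteq> f y \<longrightarrow> c x y = a \<or> c x y = b)"
proof -
  obtain f :: "'a \<Rightarrow> 'a set" where f: "module_labelling V c f" "2 \<le> card (f ` V)"
    "\<And>g :: 'a \<Rightarrow> 'a set. module_labelling V c g \<Longrightarrow> 2 \<le> card (g ` V) \<Longrightarrow> card (f ` V) \<le> card (g ` V)"
    using coarsest_labelling[OF fin two] by metis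
  obtain T where T: "T \<subseteq> V" "inj_on f T" "f ` T = f ` V"
    using subset_image_inj[of "f ` V" f V] by auto
  have "2 \<le> card T" using f(2) T by (metis card_image)
  moreover have "finite T" "gallai_on T c" "prime_coloring T c"
    using finite_subset[OF T(1) fin] gallai_on_subset[OF gal T(1)] transversal_prime[OF fin sym f(1) f(3) T]
    by auto
  ultimately obtain a b where ab: "\<forall>x\<in>T. \<forall>y\<in>T. x \<noteq> y \<longrightarrow> c x y = a \<or> c x y = b"
    using prime_two_colors[of T c] sym by blast
  have cross: "c x y = a \<or> c x y = b" if xy: "x \<in> V" "y \<in> V" "f x \<noteq> f y" for x y
  proof -
    have "f x \<in> f ` T" "f y \<in> f ` T" using xy T(3) by auto
    then obtain s t where st: "s \<in> T" "t \<in> T" "f x = f s" "f y = f t" by auto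
    have "c x y = c s y" using f(1) xy st T(1) unfolding module_labelling_def by (metis subsetD)
    also have "\<dots> = c y s" by (rule sym)
    also have "\<dots> = c t s" using f(1) xy st T(1) unfolding module_labelling_def by (metis subsetD)
    also have "\<dots> = c s t" by (rule sym)
    finally show ?thesis using ab st xy by auto
  qed
  show ?thesis
  proof (intro exI conjI)
    show "module_labelling V c f" "2 \<le> card (f ` V)" by fact+
    show "\<forall>x\<in>V. \<forall>y\<in>V. f x \<noteq> f y \<longrightarrow> c x y = a \<or> c x y = b" using cross by simp
  qed
qed

section \<open>Path numbers of Gallai colourings\<close>

lemma sum_two_others:
  fixes g :: "'c \<Rightarrow> nat"
  assumes "finite C" "a \<in> C" "b \<in> C" "a \<noteq> b"
  shows "sum g C = g a + g b + sum g (C - {a, b})"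
proof -
  have "sum g C = g a + sum g (C - {a})" using assms by (simp add: sum.remove)
  also have "sum g (C - {a}) = g b + sum g (C - {a} - {b})" using assms by (intro sum.remove) auto
  also have "C - {a} - {b} = C - {a, b}" by auto
  finally show ?thesis by simp
qed

text \<open>A longest \<open>a\<close>-path \<open>P\<close> across parts bounds
  \<open>card (set P)\<close>, and \<open>long_blue_path\<close> bounds
  \<open>card (V - set P)\<close>. The hypothesis \<open>le\<close> compares paths across parts
  because the locale sees only these.\<close>

lemma balanced_bound:
  assumes fin: "finite V" "V \<noteq> {}" and sym: "\<And>x y. c x y = c y x"
    and f: "module_labelling V c f"
    and ab: "\<And>x y. x \<in> V \<Longrightarrow> y \<in> V \<Longrightarrow> f x \<noteq> f y \<Longrightarrow> c x y = a \<or> c x y = b" "a \<noteq> b"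
    and bal: "\<And>x. x \<in> V \<Longrightarrow> card {y \<in> V. f y = f x} \<le> card {y \<in> V. f x \<noteq> f y \<and> c x y = a}
      \<or> card {y \<in> V. f y = f x} \<le> card {y \<in> V. f x \<noteq> f y \<and> c x y = b}"
    and le: "path_number (\<lambda>x y. f x \<noteq> f y \<and> c x y = b) V \<le> path_number (\<lambda>x y. f x \<noteq> f y \<and> c x y = a) V"
  shows "card V \<le> path_number (\<lambda>x y. c x y = a) V + (path_number (\<lambda>x y. c x y = b) V - 1) div 2"
proof -
  \<comment> \<open>Membership in \<open>V\<close> is included because \<open>red_module\<close>
    leaves \<open>y\<close> unrestricted.\<close>
  define red where "red x y \<longleftrightarrow> x \<in> V \<and> y \<in> V \<and> f x \<noteq> f y \<and> c x y = a" for x y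
  obtain P where longest: "path_in (\<lambda>x y. f x \<noteq> f y \<and> c x y = a) V P"
    "length P = path_number (\<lambda>x y. f x \<noteq> f y \<and> c x y = a) V"
    using path_number_attained[OF fin(1)] .
  have Pr: "path_in red V P" using longest(1) order_refl by (rule path_in_mono) (auto simp: red_def)
  have maxP: "length xs \<le> length P" if "path_in red V xs" for xs
  proof -
    have "path_in (\<lambda>x y. f x \<noteq> f y \<and> c x y = a) V xs"
      using that order_refl by (rule path_in_mono) (auto simp: red_def)
    from length_le_path_number[OF fin(1) this] show ?thesis using longest(2) by simp
  qed
  have blue: "path_in (\<lambda>x y. f x \<noteq> f y \<and> c x y = b) V xs"
    if "path_in (\<lambda>x y. \<not> red x y \<and> f x \<noteq> f y) V xs" for xs
    using that order_refl by (rule path_in_mono) (use ab in \<open>auto simp: red_def\<close>)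
  interpret two_coloured_modules V red f P
  proof
    show "finite V" by fact
    show "red x y \<Longrightarrow> red y x" for x y by (auto simp: red_def sym)
    show "red x y \<Longrightarrow> f x \<noteq> f y" for x y by (auto simp: red_def)
    show "red x' y" if "x \<in> V" "x' \<in> V" "f x = f x'" "red x y" for x x' y
    proof -
      have "c x y = c x' y" using f that unfolding module_labelling_def red_def by metis
      then show ?thesis using that by (simp add: red_def)
    qed
    show "path_in red V P" by fact
    show "P \<noteq> []" using longest(2) path_number_pos[OF fin, of "\<lambda>x y. f x \<noteq> f y \<and> c x y = a"] by auto
    show "length xs \<le> length P" if "path_in red V xs" for xs using maxP[OF that] .
    show "length xs \<le> length P" if "path_in (\<lambda>x y. \<not> red x y \<and> f x \<noteq> f y) V xs" for xs
      using length_le_path_number[OF fin(1) blue[OF that]] le longest(2) by simp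
    fix x assume x: "x \<in> V"
    have "{y \<in> V. red x y} = {y \<in> V. f x \<noteq> f y \<and> c x y = a}" using x by (auto simp: red_def)
    moreover have "{y \<in> V. \<not> red x y \<and> f x \<noteq> f y} = {y \<in> V. f x \<noteq> f y \<and> c x y = b}"
      using x ab by (auto simp: red_def)
    ultimately show "card {y \<in> V. f y = f x} \<le> card {y \<in> V. red x y}
      \<or> card {y \<in> V. f y = f x} \<le> card {y \<in> V. \<not> red x y \<and> f x \<noteq> f y}"
      using bal[OF x] by simp
  qed
  obtain Q where Q: "path_in (\<lambda>x y. \<not> red x y \<and> f x \<noteq> f y) V Q" "2 * card (V - set P) + 1 \<le> length Q"
    using long_blue_path by blast
  have "path_in (\<lambda>x y. c x y = b) V Q" using blue[OF Q(1)] order_refl by (rule path_in_mono) auto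
  then have 1: "2 * card (V - set P) + 1 \<le> path_number (\<lambda>x y. c x y = b) V"
    using Q(2) length_le_path_number[OF fin(1)] by (meson le_trans)
  have "path_in (\<lambda>x y. c x y = a) V P" using longest(1) order_refl by (rule path_in_mono) auto
  then have 2: "length P \<le> path_number (\<lambda>x y. c x y = a) V" by (rule length_le_path_number[OF fin(1)])
  have "card V = card (set P) + card (V - set P)"
    using fin(1) Pr by (metis path_in_def card_Diff_subset card_mono finite_set le_add_diff_inverse)
  also have "card (set P) = length P" using Pr by (simp add: path_in_def distinct_card)
  finally show ?thesis using 1 2 by linarith
qed

text \<open>By \<open>join_path\<close> each vertex of \<open>R\<close> adds two to the path number
  of colour \<open>a\<close>, and each vertex of \<open>B\<close> two to that of \<open>b\<close>,
  as the induction needs. Otherwise one of these colours has a path as long as \<open>X\<close>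
  together with its neighbourhood, and this colour takes the role of \<open>i\<close>.\<close>

lemma dominant_module_bound:
  assumes fin: "finite X" "finite R" "finite B"
    and disj: "X \<inter> R = {}" "X \<inter> B = {}" "R \<inter> B = {}" and V: "V = X \<union> R \<union> B"
    and sym: "\<And>x y. c x y = c y x"
    and R: "\<And>x y. x \<in> X \<Longrightarrow> y \<in> R \<Longrightarrow> c x y = a" and B: "\<And>x y. x \<in> X \<Longrightarrow> y \<in> B \<Longrightarrow> c x y = b"
    and small: "card R < card X" "card B < card X"
    and C: "finite C" "a \<in> C" "b \<in> C" "a \<noteq> b"
    and IH: "\<exists>i\<in>C. card X \<le> 1 + path_number (\<lambda>x y. c x y = i) X div 2
      + (\<Sum>j\<in>C. (path_number (\<lambda>x y. c x y = j) X - 1) div 2)"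
  shows "\<exists>i\<in>C. card V \<le> 1 + path_number (\<lambda>x y. c x y = i) V div 2
      + (\<Sum>j\<in>C. (path_number (\<lambda>x y. c x y = j) V - 1) div 2)"
proof -
  define q where "q j = path_number (\<lambda>x y. c x y = j) X" for j
  define p where "p j = path_number (\<lambda>x y. c x y = j) V" for j
  have finV: "finite V" using fin V by simp
  have qp: "q j \<le> p j" for j unfolding q_def p_def using finV V by (intro path_number_mono) auto
  have "X \<noteq> {}" using small by auto
  then have q0: "0 < q j" for j unfolding q_def using fin by (intro path_number_pos)
  have join: "min (q e + 2 * card Y) (card X + card Y) \<le> p e"
    if Y: "finite Y" "X \<inter> Y = {}" "Y \<subseteq> V" "card Y < card X" and e: "\<And>x y. x \<in> X \<Longrightarrow> y \<in> Y \<Longrightarrow> c x y = e" for Y e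
  proof -
    obtain xs where xs: "path_in (\<lambda>x y. c x y = e) X xs" "length xs = q e"
      unfolding q_def using path_number_attained[OF fin(1)] .
    have "min (length xs + 2 * card Y) (card X + card Y) \<le> path_number (\<lambda>x y. c x y = e) (X \<union> Y)"
    proof (rule join_path[OF fin(1) Y(1,2) _ _ xs(1)])
      show "card Y \<le> card X" using Y by simp
      show "c x y = e \<and> c y x = e" if "x \<in> X" "y \<in> Y" for x y using e[OF that] sym[of y x] by simp
    qed
    also have "\<dots> \<le> p e" unfolding p_def using finV V Y by (intro path_number_mono) auto
    finally show ?thesis using xs by simp
  qed
  have ja: "min (q a + 2 * card R) (card X + card R) \<le> p a"
    using fin disj V small R by (intro join) auto
  have jb: "min (q b + 2 * card B) (card X + card B) \<le> p b"
    using fin disj V small B by (intro join) auto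
  have "card V = card (X \<union> R) + card B"
    unfolding V using fin disj by (intro card_Un_disjoint) auto
  also have "card (X \<union> R) = card X + card R" using fin disj by (intro card_Un_disjoint) auto
  finally have cV: "card V = card X + card R + card B" .
  define g where "g j = (p j - 1) div 2" for j
  define h where "h j = (q j - 1) div 2" for j
  have sg: "sum g C = g a + g b + sum g (C - {a, b})" and sh: "sum h C = h a + h b + sum h (C - {a, b})"
    using sum_two_others[OF C] by auto
  have others: "sum h (C - {a, b}) \<le> sum g (C - {a, b})"
    unfolding g_def h_def by (intro sum_mono div_le_mono diff_le_mono qp)
  obtain i where i: "i \<in> C" "card X \<le> 1 + q i div 2 + sum h C" using IH unfolding q_def h_def by auto
  have "\<exists>i\<in>C. card V \<le> 1 + p i div 2 + sum g C"
  proof (cases "q a + 2 * card R \<le> p a \<and> q b + 2 * card B \<le> p b")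
    case True
    then have "h a + card R \<le> g a" "h b + card B \<le> g b"
      using q0[of a] q0[of b] unfolding g_def h_def by linarith+
    moreover have "q i div 2 \<le> p i div 2" using qp by (rule div_le_mono)
    ultimately have "card V \<le> 1 + p i div 2 + sum g C" using i(2) sg sh others cV by linarith
    then show ?thesis using i by blast
  next
    case False
    then consider "card X + card R \<le> p a" | "card X + card B \<le> p b" using ja jb by linarith
    then show ?thesis
    proof cases
      case 1
      \<comment> \<open>Since \<open>card B < card X\<close>, both terms of the minimum in
        \<open>jb\<close> are at least \<open>2 * card B + 1\<close>.\<close>
      have "card B \<le> g b" using jb small q0[of b] unfolding g_def by linarith
      \<comment> \<open>Here \<open>n = 1 + n div 2 + (n - 1) div 2\<close> for positive
        \<open>n\<close>.\<close>
      moreover have "card X + card R \<le> 1 + p a div 2 + g a" using 1 unfolding g_def by linarith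
      ultimately show ?thesis using sg cV C by (intro bexI[of _ a]) auto
    next
      case 2
      have "card R \<le> g a" using ja small q0[of a] unfolding g_def by linarith
      moreover have "card X + card B \<le> 1 + p b div 2 + g b" using 2 unfolding g_def by linarith
      ultimately show ?thesis using sg cV C by (intro bexI[of _ b]) auto
    qed
  qed
  then show ?thesis unfolding p_def g_def .
qed

theorem gallai_path_bound:
  fixes c :: "'a \<Rightarrow> 'a \<Rightarrow> 'c"
  assumes "finite V" "V \<noteq> {}" "\<And>x y. c x y = c y x" "gallai_on V c"
    and "finite C" "2 \<le> card C" "\<And>x y. x \<in> V \<Longrightarrow> y \<in> V \<Longrightarrow> x \<noteq> y \<Longrightarrow> c x y \<in> C"
  shows "\<exists>i\<in>C. card V \<le> 1 + path_number (\<lambda>x y. c x y = i) V div 2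
      + (\<Sum>j\<in>C. (path_number (\<lambda>x y. c x y = j) V - 1) div 2)"
  using assms
proof (induction "card V" arbitrary: V rule: less_induct)
  case less
  note fin = less.prems(1,2) and sym = less.prems(3) and gal = less.prems(4)
    and C = less.prems(5,6) and colC = less.prems(7)
  have C2: "\<exists>e'\<in>C. e' \<noteq> e" for e
  proof (rule ccontr)
    assume "\<not> ?thesis"
    then have "C \<subseteq> {e}" by auto
    then have "card C \<le> 1" using card_mono[of "{e}" C] by simp
    then show False using C by simp
  qed
  show ?case
  proof (cases "card V \<le> 1")
    case True
    then show ?thesis using C2[of undefined] by force
  next
    case False
    then have two: "2 \<le> card V" by simp
    obtain f :: "'a \<Rightarrow> 'a set" and a0 b0 where part: "module_labelling V c f \<and> 2 \<le> card (f ` V) \<and>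
        (\<forall>x\<in>V. \<forall>y\<in>V. f x \<noteq> f y \<longrightarrow> c x y = a0 \<or> c x y = b0)"
      using gallai_partition[OF fin(1) sym gal two] by (elim exE) (rule that)
    then have f: "module_labelling V c f" "2 \<le> card (f ` V)"
      and ab0: "\<And>x y. x \<in> V \<Longrightarrow> y \<in> V \<Longrightarrow> f x \<noteq> f y \<Longrightarrow> c x y = a0 \<or> c x y = b0"
      by blast+
    have crossC: "c x y \<in> C" if "x \<in> V" "y \<in> V" "f x \<noteq> f y" for x y
      using colC that by metis
    \<comment> \<open>If \<open>a0\<close>, \<open>b0\<close> coincide or one is outside
      \<open>C\<close>, there is a single colour between parts, and the second is any other element
      of \<open>C\<close>.\<close>
    have "\<exists>a b. a \<in> C \<and> b \<in> C \<and> a \<noteq> b \<and> (\<forall>x\<in>V. \<forall>y\<in>V. f x \<noteq> f y \<longrightarrow> c x y = a \<or> c x y = b)"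
    proof (cases "a0 \<in> C \<and> b0 \<in> C \<and> a0 \<noteq> b0")
      case True
      then show ?thesis using ab0 by blast
    next
      case False
      then have "\<exists>e\<in>C. \<forall>x\<in>V. \<forall>y\<in>V. f x \<noteq> f y \<longrightarrow> c x y = e"
        using ab0 crossC C2 by metis
      then show ?thesis using C2 by metis
    qed
    then obtain a b where ab: "a \<in> C" "b \<in> C" "a \<noteq> b"
      "\<And>x y. x \<in> V \<Longrightarrow> y \<in> V \<Longrightarrow> f x \<noteq> f y \<Longrightarrow> c x y = a \<or> c x y = b" by blast
    define X where "X x = {y \<in> V. f y = f x}" for x
    define N where "N x e = {y \<in> V. f x \<noteq> f y \<and> c x y = e}" for x e
    show ?thesis
    proof (cases "\<exists>x\<in>V. card (N x a) < card (X x) \<and> card (N x b) < card (X x)")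
      case True
      then obtain x where x: "x \<in> V" "card (N x a) < card (X x)" "card (N x b) < card (X x)" by auto
      have Xc: "c x' y = e" if "x' \<in> X x" "y \<in> N x e" for x' y e
        using f(1) x that unfolding module_labelling_def X_def N_def
        by (metis (mono_tags, lifting) mem_Collect_eq)
      have XV: "X x \<subseteq> V" by (auto simp: X_def)
      have "X x \<noteq> V"
      proof
        assume "X x = V"
        then have "f ` V \<subseteq> {f x}" by (auto simp: X_def)
        then have "card (f ` V) \<le> 1" using card_mono[of "{f x}"] by simp
        then show False using f(2) by simp
      qed
      then have "card (X x) < card V" using XV fin by (intro psubset_card_mono) auto
      moreover have "finite (X x)" "X x \<noteq> {}" using XV fin x by (auto simp: X_def)
      ultimately have IH: "\<exists>i\<in>C. card (X x) \<le> 1 + path_number (\<lambda>x y. c x y = i) (X x) div 2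
          + (\<Sum>j\<in>C. (path_number (\<lambda>x y. c x y = j) (X x) - 1) div 2)"
        using sym gallai_on_subset[OF gal XV] C colC subsetD[OF XV]
        by (intro less.hyps) simp_all
      show ?thesis
      proof (rule dominant_module_bound[OF _ _ _ _ _ _ _ sym Xc Xc x(2,3) C(1) ab(1-3) IH])
        show "V = X x \<union> N x a \<union> N x b" using ab(4)[OF x(1)] by (auto simp: X_def N_def)
      qed (use fin ab(3) in \<open>auto simp: X_def N_def\<close>)
    next
      case False
      then have bal: "card (X x) \<le> card (N x a) \<or> card (X x) \<le> card (N x b)" if "x \<in> V" for x
        using that by (meson not_le)
      define p where "p e = path_number (\<lambda>x y. c x y = e) V" for e
      have pos: "0 < p e" for e unfolding p_def using fin by (rule path_number_pos)
      have sum: "(p a - 1) div 2 + (p b - 1) div 2 \<le> (\<Sum>j\<in>C. (p j - 1) div 2)"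
        using sum_two_others[OF C(1) ab(1-3)] by simp
      \<comment> \<open>The colour with the longer path across parts has to play red in
        \<open>balanced_bound\<close>.\<close>
      have "card V \<le> p a + (p b - 1) div 2 \<or> card V \<le> p b + (p a - 1) div 2"
      proof (cases "path_number (\<lambda>x y. f x \<noteq> f y \<and> c x y = b) V \<le> path_number (\<lambda>x y. f x \<noteq> f y \<and> c x y = a) V")
        case True
        have "card V \<le> p a + (p b - 1) div 2"
          unfolding p_def
          by (rule balanced_bound[OF fin sym f(1) ab(4,3) _ True])
             (use bal in \<open>auto simp: X_def N_def\<close>)
        then show ?thesis by blast
      next
        case False
        then have le: "path_number (\<lambda>x y. f x \<noteq> f y \<and> c x y = a) V \<le> path_number (\<lambda>x y. f x \<noteq> f y \<and> c x y = b) V"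
          by simp
        have ba: "c x y = b \<or> c x y = a" if "x \<in> V" "y \<in> V" "f x \<noteq> f y" for x y using ab(4)[OF that] by blast
        have "card V \<le> p b + (p a - 1) div 2"
          unfolding p_def
          by (rule balanced_bound[OF fin sym f(1) ba ab(3)[symmetric] _ le])
             (use bal in \<open>auto simp: X_def N_def\<close>)
        then show ?thesis by blast
      qed
      then have "card V \<le> 1 + p a div 2 + (\<Sum>j\<in>C. (p j - 1) div 2)
          \<or> card V \<le> 1 + p b div 2 + (\<Sum>j\<in>C. (p j - 1) div 2)"
        using sum pos[of a] pos[of b] by linarith
      then have "\<exists>i\<in>C. card V \<le> 1 + p i div 2 + (\<Sum>j\<in>C. (p j - 1) div 2)"
        using ab(1,2) by blast
      then show ?thesis unfolding p_def .
    qed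
  qed
qed

section \<open>Gallai--Ramsey numbers of paths\<close>

lemma pair_in_complete_graph: "{x, y} \<in> edges (complete_graph N) \<longleftrightarrow> x < N \<and> y < N \<and> x \<noteq> y"
  by (auto simp: complete_graph_def nsets_def card_insert_if)

lemma monochromatic_path_iff:
  "has_monochromatic_copy (complete_graph N) c (path_graph m) \<longleftrightarrow>
    (\<exists>xs i. path_in (\<lambda>x y. c {x, y} = i) {..<N} xs \<and> length xs = m)"
proof
  assume "has_monochromatic_copy (complete_graph N) c (path_graph m)"
  then obtain G' i where sub: "subgraph G' (complete_graph N)" and iso: "isomorphic (path_graph m) G'"
    and mono: "\<forall>e\<in>edges G'. c e = i"
    unfolding has_monochromatic_copy_def by auto
  obtain f where f: "bij_betw f {..<m} (verts G')"
    and fe: "\<And>x y. x < m \<Longrightarrow> y < m \<Longrightarrow> {x, y} \<in> edges (path_graph m) \<longleftrightarrow> {f x, f y} \<in> edges G'"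
    using iso unfolding isomorphic_def path_graph_def by auto
  have "path_in (\<lambda>x y. c {x, y} = i) {..<N} (map f [0..<m])"
    unfolding path_in_def
  proof (intro conjI)
    show "distinct (map f [0..<m])" using f by (auto simp: distinct_map bij_betw_def atLeast0LessThan)
    have "f ` {..<m} = verts G'" using f by (simp add: bij_betw_def)
    then show "set (map f [0..<m]) \<subseteq> {..<N}"
      using sub by (auto simp: subgraph_def complete_graph_def atLeast0LessThan)
    have "c {f j, f (Suc j)} = i" if "Suc j < m" for j
    proof -
      have "{j, Suc j} \<in> edges (path_graph m)" using that by (auto simp: path_graph_def)
      then show ?thesis using fe[of j "Suc j"] that mono by auto
    qed
    then show "successively (\<lambda>x y. c {x, y} = i) (map f [0..<m])"
      by (auto simp: successively_conv_nth)
  qed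
  then show "\<exists>xs i. path_in (\<lambda>x y. c {x, y} = i) {..<N} xs \<and> length xs = m"
    by (intro exI[of _ "map f [0..<m]"] exI[of _ i]) simp
next
  assume "\<exists>xs i. path_in (\<lambda>x y. c {x, y} = i) {..<N} xs \<and> length xs = m"
  then obtain xs i where xs: "distinct xs" "set xs \<subseteq> {..<N}" "successively (\<lambda>x y. c {x, y} = i) xs"
    and m: "length xs = m" by (auto simp: path_in_def)
  define G' where "G' = (set xs, {{xs ! j, xs ! Suc j} | j. Suc j < m})"
  have nth: "xs ! j = xs ! l \<longleftrightarrow> j = l" if "j < m" "l < m" for j l
    using that xs(1) m by (simp add: nth_eq_iff_index_eq)
  have "subgraph G' (complete_graph N)"
  proof -
    have e: "{xs ! j, xs ! Suc j} \<in> [set xs]\<^bsup>2\<^esup>" if "Suc j < m" for j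
      using that nth[of j "Suc j"] m by (auto simp: nsets_def card_insert_if)
    then have "edges G' \<subseteq> [set xs]\<^bsup>2\<^esup>" by (auto simp: G'_def)
    moreover have "[set xs]\<^bsup>2\<^esup> \<subseteq> [{..<N}]\<^bsup>2\<^esup>" using xs(2) by (rule nsets_mono)
    ultimately show ?thesis
      using xs(2) by (auto simp: subgraph_def is_graph_def complete_graph_def G'_def)
  qed
  moreover have "isomorphic (path_graph m) G'"
    unfolding isomorphic_def
  proof (intro exI conjI ballI)
    show "bij_betw ((!) xs) (verts (path_graph m)) (verts G')"
      using xs(1) m by (auto simp: path_graph_def G'_def intro: bij_betw_nth)
    fix x y assume "x \<in> verts (path_graph m)" "y \<in> verts (path_graph m)"
    then have xy: "x < m" "y < m" by (auto simp: path_graph_def)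
    have "{xs ! x, xs ! y} = {xs ! j, xs ! Suc j} \<longleftrightarrow> {x, y} = {j, Suc j}" if "Suc j < m" for j
      using nth[of x j] nth[of y j] nth[of x "Suc j"] nth[of y "Suc j"] xy that
      by (auto simp: doubleton_eq_iff)
    then show "{x, y} \<in> edges (path_graph m) \<longleftrightarrow> {xs ! x, xs ! y} \<in> edges G'"
      by (auto simp: path_graph_def G'_def)
  qed
  moreover have "\<forall>e\<in>edges G'. c e = i"
    using xs(3) m by (auto simp: G'_def successively_conv_nth)
  ultimately show "has_monochromatic_copy (complete_graph N) c (path_graph m)"
    unfolding has_monochromatic_copy_def by blast
qed

section \<open>Upper bound\<close>

text \<open>Without a monochromatic path on \<open>m\<close> vertices all path numbers are at most
  \<open>m - 1\<close>, and \<open>gallai_path_bound\<close> then allows one vertex fewer than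
  stated here.\<close>

lemma gallai_property_upper:
  assumes k: "2 \<le> k" and m: "2 \<le> m"
  shows "gallai_ramsey_property k (path_graph m) (2 + (m - 1) div 2 + k * ((m - 2) div 2))"
  unfolding gallai_ramsey_property_def
proof (intro allI impI)
  define N where "N = 2 + (m - 1) div 2 + k * ((m - 2) div 2)"
  fix c assume "gallai_coloring k (complete_graph (2 + (m - 1) div 2 + k * ((m - 2) div 2))) c"
  then have c: "gallai_coloring k (complete_graph N) c" by (simp add: N_def)
  define p where "p i = path_number (\<lambda>x y. c {x, y} = i) {..<N}" for i
  have "has_monochromatic_copy (complete_graph N) c (path_graph m)"
  proof (rule ccontr)
    assume neg: "\<not> ?thesis"
    have p: "p i \<le> m - 1" for i
    proof (rule ccontr)
      assume *: "\<not> p i \<le> m - 1"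
      obtain xs where xs: "path_in (\<lambda>x y. c {x, y} = i) {..<N} xs" "length xs = p i"
        unfolding p_def using path_number_attained[OF finite_lessThan] .
      have "successively (\<lambda>x y. c {x, y} = i) (take m xs @ drop m xs)"
        using xs(1) by (simp add: path_in_def)
      then have "successively (\<lambda>x y. c {x, y} = i) (take m xs)"
        unfolding successively_append_iff by blast
      then have "path_in (\<lambda>x y. c {x, y} = i) {..<N} (take m xs)"
        using xs(1) set_take_subset[of m xs] by (auto simp: path_in_def)
      moreover have "length (take m xs) = m" using xs(2) * by simp
      ultimately show False using neg monochromatic_path_iff by blast
    qed
    have "gallai_on {..<N} (\<lambda>x y. c {x, y})"
      unfolding gallai_on_def
    proof (intro ballI impI)
      fix x y z assume "x \<in> {..<N}" "y \<in> {..<N}" "z \<in> {..<N}" "x \<noteq> y" "y \<noteq> z" "x \<noteq> z"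
      then have "\<not> (c {x, y} \<noteq> c {y, z} \<and> c {y, z} \<noteq> c {x, z} \<and> c {x, y} \<noteq> c {x, z})"
        using c unfolding gallai_coloring_def rainbow_triangle_def pair_in_complete_graph by auto
      then show "c {x, y} = c {y, z} \<or> c {y, z} = c {x, z} \<or> c {x, y} = c {x, z}" by blast
    qed
    moreover have "c {x, y} \<in> {1..k}" if "x \<in> {..<N}" "y \<in> {..<N}" "x \<noteq> y" for x y
      using c that pair_in_complete_graph[of x y N] unfolding gallai_coloring_def edge_coloring_def by blast
    moreover have "{..<N} \<noteq> {}" by (auto simp: N_def)
    moreover have "c {x, y} = c {y, x}" for x y by (simp add: insert_commute)
    ultimately have "\<exists>i\<in>{1..k}. card {..<N} \<le> 1 + p i div 2 + (\<Sum>j\<in>{1..k}. (p j - 1) div 2)"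
      unfolding p_def using k by (intro gallai_path_bound) simp_all
    then obtain i where "N \<le> 1 + p i div 2 + (\<Sum>j\<in>{1..k}. (p j - 1) div 2)" by auto
    moreover have "p i div 2 \<le> (m - 1) div 2" using p by (rule div_le_mono)
    moreover have "(\<Sum>j\<in>{1..k}. (p j - 1) div 2) \<le> (\<Sum>j\<in>{1..k}. (m - 2) div 2)"
    proof (rule sum_mono)
      fix j
      show "(p j - 1) div 2 \<le> (m - 2) div 2" using p[of j] by (intro div_le_mono) simp
    qed
    ultimately show False by (simp add: N_def)
  qed
  then show "has_monochromatic_copy (complete_graph (2 + (m - 1) div 2 + k * ((m - 2) div 2))) c (path_graph m)"
    by (simp add: N_def)
qed

section \<open>Lower bound\<close>

text \<open>The colour of an edge depends only on its larger end: colour 1 is a clique on \<open>m - 1\<close>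
  vertices, and every other colour is covered by a block of \<open>(m - 2) div 2\<close> vertices.\<close>
lemma gallai_property_lower:
  assumes k: "1 \<le> k" and m: "4 \<le> m" and N: "N < 2 + (m - 1) div 2 + k * ((m - 2) div 2)"
  shows "\<not> gallai_ramsey_property k (path_graph m) N"
proof -
  define w where "w = (m - 2) div 2"
  have w: "0 < w" "2 * w \<le> m - 2" using m by (auto simp: w_def)
  \<comment> \<open>The bound on \<open>N\<close> becomes a clique of \<open>m - 1\<close> vertices
    plus \<open>k - 1\<close> blocks of size \<open>w\<close>.\<close>
  have "(m - 1) div 2 + w = m - 2" using m unfolding w_def by linarith
  moreover have "k * w = w + (k - 1) * w" using k by (cases k) auto
  ultimately have N': "N \<le> m - 1 + (k - 1) * w" using N m unfolding w_def[symmetric] by linarith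
  define h where "h z = (if z < m - 1 then 1 else 2 + (z - (m - 1)) div w)" for z
  define c :: "nat set \<Rightarrow> nat" where "c e = h (Max e)" for e
  have c: "c {x, y} = h (max x y)" for x y by (simp add: c_def)
  have hk: "h z \<in> {1..k}" if "z < N" for z
  proof (cases "z < m - 1")
    case True
    then show ?thesis using k by (simp add: h_def)
  next
    case False
    then have "z - (m - 1) < (k - 1) * w" using that N' by linarith
    then have "(z - (m - 1)) div w < k - 1" by (rule less_mult_imp_div_less)
    then show ?thesis using False by (simp add: h_def)
  qed
  have h1: "z < m - 1" if "h z = 1" for z
    using that unfolding h_def by (cases "z < m - 1") auto
  have "gallai_coloring k (complete_graph N) c"
    unfolding gallai_coloring_def
  proof
    show "edge_coloring k (complete_graph N) c"
      unfolding edge_coloring_def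
    proof
      fix e assume "e \<in> edges (complete_graph N)"
      then have e: "e \<subseteq> {..<N}" "finite e" "card e = 2" by (auto simp: complete_graph_def nsets_def)
      then have "Max e \<in> e" by (intro Max_in) auto
      then show "c e \<in> {1..k}" unfolding c_def using e by (intro hk) auto
    qed
    \<comment> \<open>The two edges at the largest vertex of a triangle have the same
      colour.\<close>
    show "\<nexists>x y z. rainbow_triangle (complete_graph N) c x y z"
      unfolding rainbow_triangle_def c by (auto simp: max_def split: if_splits)
  qed
  moreover have "\<not> has_monochromatic_copy (complete_graph N) c (path_graph m)"
    unfolding monochromatic_path_iff
  proof (rule notI, elim exE conjE)
    fix xs i assume xs: "path_in (\<lambda>x y. c {x, y} = i) {..<N} xs" and len: "length xs = m"
    then have d: "distinct xs" "successively (\<lambda>x y. h (max x y) = i) xs" by (auto simp: path_in_def c)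
    show False
    proof (cases "i = 1")
      case True
      have "x < m - 1" if x: "x \<in> set xs" for x
      proof -
        obtain j where j: "j < m" "x = xs ! j" using x unfolding in_set_conv_nth len by blast
        have adj: "max (xs ! l) (xs ! Suc l) < m - 1" if "Suc l < m" for l
        proof -
          have "h (max (xs ! l) (xs ! Suc l)) = 1" using successively_nth[OF d(2)] that len True by simp
          then show ?thesis by (rule h1)
        qed
        show ?thesis
        proof (cases "Suc j < m")
          case True
          then show ?thesis using adj[of j] j by simp
        next
          case False
          then have "Suc (j - 1) = j" using j m by simp
          then show ?thesis using adj[of "j - 1"] j by simp
        qed
      qed
      then have "set xs \<subseteq> {..<m - 1}" by auto
      then have "card (set xs) \<le> m - 1" using card_mono[of "{..<m - 1}" "set xs"] by simp
      then show False using len d(1) m by (simp add: distinct_card)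
    next
      case False
      \<comment> \<open>The larger end of each edge lies in the block of colour \<open>i\<close>, so
        \<open>w\<close> vertices cover the path and
        \<open>m \<le> 2 * w + 1 \<le> m - 1\<close>.\<close>
      have "successively (\<lambda>x y. h x = i \<or> h y = i) xs"
        using d(2) by (rule successively_mono) (auto simp: max_def split: if_splits)
      then have "m \<le> 2 * length (filter (\<lambda>x. h x = i) xs) + 1"
        unfolding len[symmetric] by (rule cover_path_free)
      also have "length (filter (\<lambda>x. h x = i) xs) = card {x \<in> set xs. h x = i}"
        using d(1) by (rule length_filter_card)
      also have "\<dots> \<le> card {m - 1 + (i - 2) * w..<m - 1 + (i - 2) * w + w}"
      proof (rule card_mono)
        show "{x \<in> set xs. h x = i} \<subseteq> {m - 1 + (i - 2) * w..<m - 1 + (i - 2) * w + w}"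
        proof
          fix x assume "x \<in> {x \<in> set xs. h x = i}"
          then have x: "m - 1 \<le> x" "(x - (m - 1)) div w = i - 2"
            using False by (auto simp: h_def split: if_splits)
          have "x - (m - 1) = (i - 2) * w + (x - (m - 1)) mod w"
            using div_mult_mod_eq[of "x - (m - 1)" w] unfolding x(2) by (rule sym)
          moreover have "(x - (m - 1)) mod w < w" using w by simp
          ultimately have "m - 1 + (i - 2) * w \<le> x \<and> x < m - 1 + (i - 2) * w + w"
            using x(1) by linarith
          then show "x \<in> {m - 1 + (i - 2) * w..<m - 1 + (i - 2) * w + w}" by simp
        qed
      qed simp
      finally show False using w m by simp
    qed
  qed
  ultimately show ?thesis unfolding gallai_ramsey_property_def by blast
qed

theorem GR_path_graph:
  assumes "2 \<le> k" "4 \<le> m"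
  shows "GR k (path_graph m) = 2 + (m - 1) div 2 + k * ((m - 2) div 2)"
  unfolding GR_def
proof (rule Least_equality)
  show "0 < 2 + (m - 1) div 2 + k * ((m - 2) div 2) \<and>
    gallai_ramsey_property k (path_graph m) (2 + (m - 1) div 2 + k * ((m - 2) div 2))"
    using gallai_property_upper assms by simp
  fix N assume "0 < N \<and> gallai_ramsey_property k (path_graph m) N"
  then show "2 + (m - 1) div 2 + k * ((m - 2) div 2) \<le> N"
    using gallai_property_lower[of k m N] assms by (meson not_le le_trans one_le_numeral)
qed

theorem theorem1p9:
  fixes k m :: nat
  assumes "k \<ge> 2" and "m \<ge> 6"
  shows "(\<forall>n. m = 2 * n \<longrightarrow> GR k (path_graph m) = (n - 1) * k + n + 1) \<and>
         (\<forall>n. m = 2 * n + 1 \<longrightarrow> GR k (path_graph m) = (n - 1) * k + n + 2)"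
proof (intro conjI allI impI)
  fix n
  have GR: "GR k (path_graph m) = 2 + (m - 1) div 2 + k * ((m - 2) div 2)"
    using assms by (intro GR_path_graph) auto
  show "GR k (path_graph m) = (n - 1) * k + n + 1" if "m = 2 * n"
  proof -
    \<comment> \<open>\<open>1 \<le> n\<close> makes the truncated difference exact:
      \<open>2 + (n - 1) = n + 1\<close>.\<close>
    have "(m - 1) div 2 = n - 1" "(m - 2) div 2 = n - 1" "1 \<le> n" using that assms(2) by linarith+
    then show ?thesis using GR by simp
  qed
  show "GR k (path_graph m) = (n - 1) * k + n + 2" if "m = 2 * n + 1"
  proof -
    have "(m - 1) div 2 = n" "(m - 2) div 2 = n - 1" using that assms(2) by linarith+
    then show ?thesis using GR by simp
  qed
qed

end
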